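(* Every connected component of $\Lambda^{\mathrm{bal}}_{>0}$ is of the form $B(\zeta,p^k)$ for some $k\in\mathbb{Z}_{\ge 0}$ and some $\zeta\in p^k\Lambda^{\mathrm{bal}}_{\mathrm{odd}}$.
   Context: Let $p$ be a prime, $\mathbb{F}=\mathbb{F}_p$, $S=\mathbb{F}[x,y]$, $\mathrm{Der}_S = S\partial_x\oplus S\partial_y$. Let $\mathcal{A}=\{H_1,H_2,H_3\}$ with $H_1=\ker x$, $H_2=\ker y$, $H_3=\ker(x+y)$, $\alpha_1=x,\alpha_2=y,\alpha_3=x+y$. For $\mu=(\mu_1,\mu_2,\mu_3)\in\Lambda\coloneqq\mathbb{Z}_{\ge0}^3$, $D(\mathcal{A},\mu)=\{\theta\in\mathrm{Der}_S:\theta(\alpha_i)\in\alpha_i^{\mu_i}S,\ i=1,2,3\}$; it is free of rank 2 with a homogeneous basis whose degrees (the exponents) are unique up to order and sum to $|\mu|=\mu_1+\mu_2+\mu_3$; $\Delta(\mu)$ denotes the absolute difference of the two exponents. $\mu$ is balanced if $\mu_i\le|\mu|/2$ for all $i$; $\Lambda^{\mathrm{bal}}$ is the set of balanced elements, $\Lambda_{>0}=\{\mu:\Delta(\mu)>0\}$, $\Lambda^{\mathrm{bal}}_{>0}=\Lambda^{\mathrm{bal}}\cap\Lambda_{>0}$, $\Lambda^{\mathrm{bal}}_{\mathrm{odd}}=\{\mu\in\Lambda^{\mathrm{bal}}:|\mu|\text{ odd}\}$, $p^k\Lambda^{\mathrm{bal}}_{\mathrm{odd}}=\{p^k\nu:\nu\in\Lambda^{\mathrm{bal}}_{\mathrm{odd}}\}$.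 Two elements $\mu,\nu\in\Lambda$ are adjacent if $\mu-\nu=\pm\mathbf{e}_i$ for some $i$; connected components of $\Lambda_{>0}$ are the equivalence classes of the equivalence relation on $\Lambda_{>0}$ generated by adjacency, and the connected components of $\Lambda^{\mathrm{bal}}_{>0}$ are those connected components of $\Lambda_{>0}$ contained in $\Lambda^{\mathrm{bal}}$ (it is known that $\Lambda^{\mathrm{bal}}_{>0}$ is a union of such components). $B(\zeta,r)=\{\mu\in\Lambda:|\mu-\zeta|<r\}$. *)

theory Defs
  imports "HOL-Analysis.Analysis" "HOL-Computational_Algebra.Computational_Algebra"
begin

text \<open>The polynomial ring \<open>S = F[x,y]\<close> is \<open>F[x][y]\<close>: the outer indeterminate is \<open>y\<close>, so the
  coefficient of \<open>x^i y^j\<close> in \<open>f\<close> is \<open>coeff (coeff f j) i\<close>.\<close>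

type_synonym 'a S = "'a poly poly"

definition varx :: "'a::field S" where
  "varx = [:[:0, 1:]:]"

definition vary :: "'a::field S" where
  "vary = [:0, 1:]"

definition homogeneous :: "nat \<Rightarrow> 'a::field S \<Rightarrow> bool" where
  "homogeneous d f \<longleftrightarrow> (\<forall>i j. coeff (coeff f j) i \<noteq> 0 \<longrightarrow> i + j = d)"

definition partial_x :: "'a::field S \<Rightarrow> 'a S" where
  "partial_x f = map_poly pderiv f"

definition partial_y :: "'a::field S \<Rightarrow> 'a S" where
  "partial_y f = pderiv f"

text \<open>\<open>Der\<^sub>S\<close> is free on the partial derivatives; the derivation \<open>f \<partial>\<^sub>x + g \<partial>\<^sub>y\<close> is the pair
  \<open>(f, g)\<close>. Its degree is the polynomial degree of \<open>f\<close> and \<open>g\<close>.\<close>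

type_synonym 'a Der = "'a S \<times> 'a S"

definition der_apply :: "'a::field Der \<Rightarrow> 'a S \<Rightarrow> 'a S" where
  "der_apply \<theta> h = fst \<theta> * partial_x h + snd \<theta> * partial_y h"

definition der_scale :: "'a::field S \<Rightarrow> 'a Der \<Rightarrow> 'a Der" where
  "der_scale s \<theta> = (s * fst \<theta>, s * snd \<theta>)"

lemma module_der_scale: "module (der_scale :: 'a::field S \<Rightarrow> 'a Der \<Rightarrow> 'a Der)"
  by unfold_locales (auto simp: der_scale_def algebra_simps)

definition der_homogeneous :: "nat \<Rightarrow> 'a::field Der \<Rightarrow> bool" where
  "der_homogeneous d \<theta> \<longleftrightarrow> homogeneous d (fst \<theta>) \<and> homogeneous d (snd \<theta>)"

text \<open>The linear forms \<open>\<alpha>\<^sub>1 = x\<close>, \<open>\<alpha>\<^sub>2 = y\<close>, \<open>\<alpha>\<^sub>3 = x + y\<close> defining the three lines.\<close>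

definition alpha :: "3 \<Rightarrow> 'a::field S" where
  "alpha i = (if i = 1 then varx else if i = 2 then vary else varx + vary)"

text \<open>The set \<open>\<Lambda>\<close> of multiplicities is the whole type \<open>nat ^ 3\<close>.\<close>

type_synonym multiplicity = "nat ^ 3"

definition D :: "multiplicity \<Rightarrow> 'a::field Der set" where
  "D \<mu> = {\<theta>. \<forall>i. alpha i ^ (\<mu> $ i) dvd der_apply \<theta> (alpha i)}"

definition is_exponents :: "'a::field itself \<Rightarrow> multiplicity \<Rightarrow> nat \<Rightarrow> nat \<Rightarrow> bool" where
  "is_exponents _ \<mu> d1 d2 \<longleftrightarrow>
    (\<exists>\<theta>1 \<theta>2 :: 'a Der. \<theta>1 \<noteq> \<theta>2 \<and>
       \<not> module.dependent der_scale {\<theta>1, \<theta>2} \<and> module.span der_scale {\<theta>1, \<theta>2} = D \<mu> \<and>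
       der_homogeneous d1 \<theta>1 \<and> der_homogeneous d2 \<theta>2)"

text \<open>A homogeneous basis always exists and its degrees are unique up to order, so the
  description below is proper.\<close>

definition Delta :: "'a::field itself \<Rightarrow> multiplicity \<Rightarrow> nat" where
  "Delta F \<mu> = (THE n. \<exists>d1 d2. is_exponents F \<mu> d1 d2 \<and> n = nat \<bar>int d1 - int d2\<bar>)"

definition size_mult :: "multiplicity \<Rightarrow> nat" where
  "size_mult \<mu> = (\<Sum>i\<in>UNIV. \<mu> $ i)"

definition balanced :: "multiplicity \<Rightarrow> bool" where
  "balanced \<mu> \<longleftrightarrow> (\<forall>i. real (\<mu> $ i) \<le> real (size_mult \<mu>) / 2)"

definition Lambda_bal :: "multiplicity set" where
  "Lambda_bal = {\<mu>. balanced \<mu>}"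

definition Lambda_pos :: "'a::field itself \<Rightarrow> multiplicity set" where
  "Lambda_pos F = {\<mu>. Delta F \<mu> > 0}"

definition Lambda_bal_odd :: "multiplicity set" where
  "Lambda_bal_odd = {\<mu> \<in> Lambda_bal. odd (size_mult \<mu>)}"

definition adjacent :: "multiplicity \<Rightarrow> multiplicity \<Rightarrow> bool" where
  "adjacent \<mu> \<nu> \<longleftrightarrow> (\<exists>i. \<mu> = \<nu> + axis i 1 \<or> \<nu> = \<mu> + axis i 1)"

definition connected_in :: "multiplicity set \<Rightarrow> (multiplicity \<times> multiplicity) set" where
  "connected_in L = {(\<mu>, \<nu>). \<mu> \<in> L \<and> \<nu> \<in> L \<and>
     equivclp (\<lambda>\<mu>' \<nu>'. \<mu>' \<in> L \<and> \<nu>' \<in> L \<and> adjacent \<mu>' \<nu>') \<mu> \<nu>}"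

definition components_pos :: "'a::field itself \<Rightarrow> multiplicity set set" where
  "components_pos F = Lambda_pos F // connected_in (Lambda_pos F)"

text \<open>Components of the balanced part are components of all of \<open>\<Lambda>\<^sub>>\<^sub>0\<close> that lie in the
  balanced part.\<close>

definition components_bal_pos :: "'a::field itself \<Rightarrow> multiplicity set set" where
  "components_bal_pos F = {C \<in> components_pos F. C \<subseteq> Lambda_bal}"

text \<open>\<open>|\<mu> - \<zeta>|\<close> is the \<open>\<ell>\<^sup>1\<close>-norm of the difference taken in \<open>\<int>\<^sup>3\<close>, extending
  \<open>|\<mu>| = \<mu>\<^sub>1 + \<mu>\<^sub>2 + \<mu>\<^sub>3\<close>.\<close>

definition l1_dist :: "multiplicity \<Rightarrow> multiplicity \<Rightarrow> nat" where
  "l1_dist \<mu> \<zeta> = (\<Sum>i\<in>UNIV. nat \<bar>int (\<mu> $ i) - int (\<zeta> $ i)\<bar>)"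

definition B :: "multiplicity \<Rightarrow> nat \<Rightarrow> multiplicity set" where
  "B \<zeta> r = {\<mu>. l1_dist \<mu> \<zeta> < r}"

end

theory Submission
  imports Defs
begin

text \<open>By Saito's criterion a homogeneous basis of \<open>D \<mu>\<close> exists and \<open>Delta \<mu> = |\<mu>| - 2 d\<close>,
  where \<open>d\<close> is the least degree of a nonzero element of \<open>D \<mu>\<close>. So \<open>Delta\<close> changes by one between
  adjacent multiplicities, and where it is positive the element of least degree is unique up to
  constants. Hence \<open>Delta\<close> has no valleys at positive height, and around a local
  maximum \<open>\<zeta>\<close> of height \<open>r\<close> it equals \<open>r - |\<mu> - \<zeta>|\<close> up to distance \<open>r\<close>; the component of \<open>\<zeta>\<close> is
  therefore \<open>B \<zeta> r\<close>. A balanced component contains a local maximum because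
  \<open>3 Delta \<mu> \<le> |\<mu>|\<close> for balanced \<open>\<mu>\<close>.

  If \<open>r \<ge> 2\<close>, then \<open>\<partial>\<^sub>x\<close> and \<open>\<partial>\<^sub>y\<close> applied to the coefficients of the lowest derivation at \<open>\<zeta>\<close>
  yield elements of some \<open>D \<nu>\<close> with \<open>|\<nu> - \<zeta>| = 2\<close>, of a degree too small for \<open>Delta \<nu> = r - 2\<close>. So
  they vanish, which forces \<open>p\<close> to divide all coordinates of \<open>\<zeta>\<close>. The Frobenius map gives
  \<open>Delta (p \<mu>) = p Delta \<mu>\<close>, and induction on \<open>r\<close> shows that \<open>r\<close> is a power of \<open>p\<close>.\<close>

section \<open>Homogeneous polynomials in two variables\<close>

unbundle no Formal_Power_Series.fps_syntax \<comment> \<open>clashes with the index notation of vectors\<close>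

lemma homogeneous_0 [simp]: "homogeneous d 0"
  by (simp add: homogeneous_def)

lemma homogeneous_coeff_eq_0:
  "homogeneous d f \<Longrightarrow> i + j \<noteq> d \<Longrightarrow> coeff (coeff f j) i = 0"
  unfolding homogeneous_def by blast

lemma homogeneous_add: "homogeneous d f \<Longrightarrow> homogeneous d g \<Longrightarrow> homogeneous d (f + g)"
  unfolding homogeneous_def by (metis add.right_neutral coeff_add)

lemma homogeneous_diff: "homogeneous d f \<Longrightarrow> homogeneous d g \<Longrightarrow> homogeneous d (f - g)"
  unfolding homogeneous_def by (metis diff_0_right coeff_diff)

lemma homogeneous_mult:
  assumes "homogeneous d f" "homogeneous e g"
  shows "homogeneous (d + e) (f * g)"
  unfolding homogeneous_def
proof (intro allI impI)
  fix m n assume nz: "coeff (coeff (f * g) n) m \<noteq> 0"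
  show "m + n = d + e"
  proof (rule ccontr)
    assume ne: "m + n \<noteq> d + e"
    have "coeff (coeff f j) i * coeff (coeff g (n - j)) (m - i) = 0"
      if "j \<le> n" "i \<le> m" for i j
    proof (cases "i + j = d")
      case True
      then have "(m - i) + (n - j) \<noteq> e" using ne that by simp
      then show ?thesis using assms(2) homogeneous_coeff_eq_0 by auto
    next
      case False
      then show ?thesis using assms(1) homogeneous_coeff_eq_0 by auto
    qed
    then have "coeff (coeff (f * g) n) m = 0"
      unfolding coeff_mult coeff_sum by (intro sum.neutral ballI) simp
    with nz show False by simp
  qed
qed

definition cst :: "'a::field \<Rightarrow> 'a S" where
  "cst c = [:[:c:]:]"

lemma cst_mult: "cst (a * b) = cst a * cst b"
  and cst_minus: "cst (- a) = - cst a"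
  and cst_0 [simp]: "cst 0 = 0"
  and cst_1 [simp]: "cst 1 = 1"
  and cst_eq_0_iff [simp]: "cst a = 0 \<longleftrightarrow> a = 0"
  by (simp_all add: cst_def one_pCons)

lemma homogeneous_const: "homogeneous 0 (cst c)"
  by (auto simp: cst_def homogeneous_def coeff_pCons split: nat.splits)

lemma homogeneous_1: "homogeneous 0 1"
  using homogeneous_const[of 1] by simp

lemma homogeneous_power: "homogeneous d f \<Longrightarrow> homogeneous (n * d) (f ^ n)"
proof (induction n)
  case (Suc n)
  then show ?case using homogeneous_mult[of d f "n * d" "f ^ n"] by (simp add: add.commute)
qed (simp add: homogeneous_1)

lemma homogeneous_0_obtain:
  assumes "homogeneous 0 f"
  obtains c where "f = cst c"
proof
  show "f = cst (coeff (coeff f 0) 0)"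
    using assms unfolding homogeneous_def cst_def
    by (intro poly_eqI) (auto simp: coeff_pCons split: nat.splits)
qed

lemma homogeneous_degree_unique:
  assumes "homogeneous d f" "homogeneous e f" "f \<noteq> 0"
  shows "d = e"
proof -
  obtain j where "coeff f j \<noteq> 0" using assms(3) by (metis leading_coeff_0_iff)
  then obtain i where "coeff (coeff f j) i \<noteq> 0" by (metis leading_coeff_0_iff)
  then show ?thesis using assms unfolding homogeneous_def by metis
qed

lemma homogeneous_varx: "homogeneous 1 varx"
  by (auto simp: homogeneous_def varx_def coeff_pCons split: nat.splits)

lemma homogeneous_vary: "homogeneous 1 vary"
  by (auto simp: homogeneous_def vary_def coeff_pCons split: nat.splits if_splits)

lemma homogeneous_alpha: "homogeneous 1 (alpha i)"
  unfolding alpha_def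
  by (auto simp del: One_nat_def intro: homogeneous_varx homogeneous_vary homogeneous_add)

lemma coeff_varx_mult:
  "coeff (coeff (varx * u) j) i = (case i of 0 \<Rightarrow> 0 | Suc i' \<Rightarrow> coeff (coeff u j) i')"
  by (simp add: varx_def coeff_pCons split: nat.splits)

lemma coeff_vary_mult:
  "coeff (coeff (vary * u) j) i = (case j of 0 \<Rightarrow> 0 | Suc j' \<Rightarrow> coeff (coeff u j') i)"
  by (simp add: vary_def coeff_pCons split: nat.splits)

text \<open>Multiplication by \<open>varx\<close> or \<open>vary\<close> only shifts coefficients.
  For \<open>varx + vary\<close>, each coefficient of \<open>u\<close> off the expected degree is
  the negative of the next one on its antidiagonal, with smaller exponent of y; induction on that
  exponent ends at 0, where there is no contribution of \<open>vary\<close>.\<close>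

lemma homogeneous_alpha_multD:
  assumes h: "homogeneous n (alpha i * u)" and nz: "u \<noteq> 0"
  shows "1 \<le> n \<and> homogeneous (n - 1) u"
proof -
  consider "i = 1" | "i = 2" | "i \<noteq> 1" "i \<noteq> 2" by blast
  then have z: "coeff (coeff u b) a = 0" if "a + b + 1 \<noteq> n" for a b
  proof cases
    case 1
    then show ?thesis
      using homogeneous_coeff_eq_0[OF h, of "Suc a" b] that
      by (simp add: alpha_def coeff_varx_mult)
  next
    case 2
    then show ?thesis
      using homogeneous_coeff_eq_0[OF h, of a "Suc b"] that
      by (simp add: alpha_def coeff_vary_mult)
  next
    case 3
    then have c: "coeff (coeff (varx * u) b) a + coeff (coeff (vary * u) b) a = 0"
      if "a + b \<noteq> n" for a b
      using homogeneous_coeff_eq_0[OF h that] by (simp add: alpha_def distrib_right)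
    show ?thesis using that
    proof (induction b arbitrary: a)
      case 0
      then show ?case using c[of "Suc a" 0] by (simp add: coeff_varx_mult coeff_vary_mult)
    next
      case (Suc b)
      then show ?case
        using c[of "Suc a" "Suc b"] Suc.IH[of "Suc a"]
        by (simp add: coeff_varx_mult coeff_vary_mult)
    qed
  qed
  obtain j where "coeff u j \<noteq> 0" using nz by (metis leading_coeff_0_iff)
  then obtain k where "coeff (coeff u j) k \<noteq> 0" by (metis leading_coeff_0_iff)
  then have "k + j + 1 = n" using z by blast
  moreover have "homogeneous (n - 1) u"
    unfolding homogeneous_def
  proof (intro allI impI)
    fix a b assume "coeff (coeff u b) a \<noteq> 0"
    then have "a + b + 1 = n" using z by blast
    then show "a + b = n - 1" by simp
  qed
  ultimately show ?thesis by simp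
qed

lemma homogeneous_alpha_power_multD:
  assumes "homogeneous n (alpha i ^ k * u)" "u \<noteq> 0"
  shows "k \<le> n \<and> homogeneous (n - k) u"
  using assms
proof (induction k arbitrary: n)
  case (Suc k)
  have "alpha i \<noteq> (0 :: 'a S)"
    using homogeneous_degree_unique[of 1 "alpha i" 0]
    by (auto simp: alpha_def varx_def vary_def)
  then have "1 \<le> n \<and> homogeneous (n - 1) (alpha i ^ k * u)"
    using homogeneous_alpha_multD[of n i "alpha i ^ k * u"] Suc.prems by (simp add: mult.assoc)
  with Suc.IH[of "n - 1"] Suc.prems show ?case by auto
qed simp

section \<open>The linear forms as prime elements\<close>

lemma prime_elem_linear_poly: "prime_elem [:c, 1 :: 'b::idom:]"
proof (rule prime_elemI)
  have dvd: "[:c, 1:] dvd q \<longleftrightarrow> poly q (- c) = 0" for q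
    by (simp add: poly_eq_0_iff_dvd)
  show "\<not> [:c, 1:] dvd 1" by (simp add: dvd)
  fix a b assume "[:c, 1:] dvd a * b"
  then show "[:c, 1:] dvd a \<or> [:c, 1:] dvd b" by (simp add: dvd)
qed simp

lemma alpha_1: "alpha 1 = [:[:0, 1:]:]" and alpha_2: "alpha 2 = [:0, 1:]"
  and alpha_3: "alpha 3 = [:[:0, 1:], 1:]"
  by (simp_all add: alpha_def varx_def vary_def)

lemma all_3E:
  fixes i :: 3
  obtains "i = 1" | "i = 2" | "i = 3"
  using exhaust_3 by blast

text \<open>The second and third forms are monic linear in y, so divisibility is vanishing at a
  point of a domain. The first is constant in y and prime in \<open>'a poly\<close>, and primes of
  the coefficient ring stay prime.\<close>

lemma prime_elem_alpha: "prime_elem (alpha i)"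
  by (cases i rule: all_3E)
    (simp_all only: alpha_1 alpha_2 alpha_3 prime_elem_linear_poly lift_prime_elem_poly)

lemma alpha_nonzero [simp]: "alpha i \<noteq> 0"
  using prime_elem_alpha prime_elem_not_zeroI by blast

lemma alpha_1_dvd_iff: "alpha 1 dvd f \<longleftrightarrow> (\<forall>j. coeff (coeff f j) 0 = 0)"
  by (simp add: alpha_1 const_poly_dvd_iff poly_eq_0_iff_dvd[of _ 0, simplified, symmetric] poly_0_coeff_0)

lemma alpha_2_dvd_iff: "alpha 2 dvd f \<longleftrightarrow> coeff f 0 = 0"
  by (simp add: alpha_2 poly_eq_0_iff_dvd[of _ 0, simplified, symmetric] poly_0_coeff_0)

lemma alpha_3_dvd_iff: "alpha 3 dvd f \<longleftrightarrow> poly f (- [:0, 1:]) = 0"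
  by (simp add: alpha_3 poly_eq_0_iff_dvd)

lemma alpha_not_dvd_alpha: "i \<noteq> j \<Longrightarrow> \<not> alpha i dvd alpha j"
  by (cases i rule: all_3E; cases j rule: all_3E)
    (auto simp: alpha_1_dvd_iff alpha_2_dvd_iff alpha_3_dvd_iff,
     auto simp: alpha_1 alpha_2 alpha_3 coeff_pCons split: nat.splits)

text \<open>Powers of \<open>q\<close> are moved past \<open>r\<close> one factor at a time; this
  supplies the coprimality argument for products of powers of the linear forms.\<close>

lemma prime_elem_power_dvd_multD:
  fixes q :: "'b::idom"
  assumes q: "prime_elem q" "\<not> q dvd r" and "q ^ n dvd r * s"
  shows "q ^ n dvd s"
  using assms(3)
proof (induction n)
  case (Suc n)
  then have "q ^ n dvd r * s" by (meson dvd_trans le_imp_power_dvd le_SucI order_refl)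
  then obtain t where t: "s = q ^ n * t" using Suc.IH by blast
  obtain k where "r * s = q ^ Suc n * k" using Suc.prems by blast
  then have "q ^ n * (r * t) = q ^ n * (q * k)" by (simp add: t mult_ac)
  moreover have "q \<noteq> 0" using q by auto
  ultimately have "r * t = q * k" by simp
  then have "q dvd t" using q by (metis dvd_triv_left prime_elem_dvd_mult_iff)
  then show ?case unfolding t by (simp add: mult.commute mult_dvd_mono)
qed simp

lemma prime_elem_dvd_prodD:
  assumes "prime_elem q" "finite A" "q dvd prod f A"
  shows "\<exists>i\<in>A. q dvd f i"
  using assms(2,3)
proof (induction A)
  case empty
  then show ?case using assms(1) by (simp add: prime_elem_not_unit)
next
  case (insert x F)
  then show ?case using prime_elem_dvd_multD[OF assms(1)] by auto
qed

text \<open>A linear form that is a coordinate on the line \<open>alpha i = 0\<close>.\<close>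

definition tform :: "3 \<Rightarrow> 'a::field S" where
  "tform i = (if i = 1 then vary else varx)"

lemma homogeneous_tform: "homogeneous 1 (tform i)"
  by (simp add: tform_def homogeneous_varx homogeneous_vary del: One_nat_def)

text \<open>On the line where \<open>alpha i\<close> vanishes, one coordinate remains, and a form of
  degree \<open>d\<close> in one variable is a scalar multiple of its \<open>d\<close>-th
  power.\<close>

lemma homogeneous_mod_alpha:
  assumes h: "homogeneous d f"
  shows "\<exists>c. alpha i dvd f - cst c * tform i ^ d"
proof (cases i rule: all_3E)
  case 1
  have "coeff (coeff f j) 0 = 0" if "j \<noteq> d" for j
    using homogeneous_coeff_eq_0[OF h, of 0 j] that by simp
  moreover have "[:0, 1 :: 'a poly:] ^ d = monom 1 d"
    by (simp add: monom_altdef)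
  ultimately show ?thesis
    using 1 by (intro exI[of _ "coeff (coeff f d) 0"])
      (auto simp: cst_def alpha_1_dvd_iff tform_def vary_def)
next
  case 2
  have "coeff (coeff f 0) a = 0" if "a \<noteq> d" for a
    using homogeneous_coeff_eq_0[OF h, of a 0] that by simp
  then have "coeff f 0 = monom (coeff (coeff f 0) d) d"
    by (intro poly_eqI) auto
  also have "\<dots> = [:coeff (coeff f 0) d:] * [:0, 1:] ^ d"
    by (simp add: monom_altdef)
  finally have "coeff f 0 = [:coeff (coeff f 0) d:] * [:0, 1:] ^ d" .
  moreover have "[:[:0, 1 :: 'a:]:] ^ d = [:[:0, 1:] ^ d:]"
    by (simp add: poly_const_pow)
  ultimately show ?thesis
    using 2 by (intro exI[of _ "coeff (coeff f 0) d"])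
      (simp add: cst_def alpha_2_dvd_iff tform_def varx_def)
next
  case 3
  \<comment> \<open>Substituting y = -x turns each term of \<open>f\<close> separately into a
    multiple of x to the power \<open>d\<close>.\<close>
  have "\<exists>c. coeff f j * (- [:0, 1:]) ^ j = [:c:] * [:0, 1:] ^ d" for j
  proof (cases "j \<le> d")
    case True
    have "coeff (coeff f j) a = 0" if "a \<noteq> d - j" for a
      using homogeneous_coeff_eq_0[OF h, of a j] that by (metis add_diff_cancel_right')
    then have "coeff f j = monom (coeff (coeff f j) (d - j)) (d - j)"
      by (intro poly_eqI) auto
    also have "\<dots> = [:coeff (coeff f j) (d - j):] * [:0, 1:] ^ (d - j)"
      by (simp add: monom_altdef)
    finally have "coeff f j = [:coeff (coeff f j) (d - j):] * [:0, 1:] ^ (d - j)" .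
    moreover have "(- [:0, 1:]) ^ j = [:(- 1) ^ j:] * [:0, 1 :: 'a:] ^ j"
    proof -
      have "- [:0, 1 :: 'a:] = [:- 1:] * [:0, 1:]" by simp
      then show ?thesis by (simp only: power_mult_distrib poly_const_pow)
    qed
    ultimately have "coeff f j * (- [:0, 1:]) ^ j =
      ([:coeff (coeff f j) (d - j):] * [:(- 1) ^ j:]) * ([:0, 1:] ^ (d - j) * [:0, 1 :: 'a:] ^ j)"
      by (simp only: mult_ac)
    also have "\<dots> = [:coeff (coeff f j) (d - j) * (- 1) ^ j:] * [:0, 1 :: 'a:] ^ d"
      using True by (simp add: mult.commute flip: power_add)
    finally show ?thesis by blast
  next
    case False
    then have "coeff f j = 0"
      using homogeneous_coeff_eq_0[OF h, of _ j] by (intro poly_eqI) auto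
    then show ?thesis by (intro exI[of _ 0]) simp
  qed
  then obtain c where c: "\<And>j. coeff f j * (- [:0, 1:]) ^ j = [:c j:] * [:0, 1:] ^ d" by metis
  have "[:sum c A:] = (\<Sum>j\<in>A. [:c j:])" for A :: "nat set"
  proof (induction A rule: infinite_finite_induct)
    case (insert x F)
    have "[:sum c (insert x F):] = [:c x:] + [:sum c F:]" using insert.hyps by simp
    then show ?case using insert by simp
  qed auto
  then have "poly f (- [:0, 1:]) = [:\<Sum>j\<le>degree f. c j:] * [:0, 1:] ^ d"
    unfolding poly_altdef c by (simp only: sum_distrib_right)
  then show ?thesis
    using 3 by (intro exI[of _ "\<Sum>j\<le>degree f. c j"])
      (simp add: cst_def alpha_3_dvd_iff tform_def varx_def poly_power)
qed

section \<open>Saito bases\<close>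

lemma der_apply_alpha:
  "der_apply \<theta> (alpha 1) = fst \<theta>" "der_apply \<theta> (alpha 2) = snd \<theta>"
  "der_apply \<theta> (alpha 3) = fst \<theta> + snd \<theta>"
  by (simp_all add: der_apply_def partial_x_def partial_y_def alpha_1 alpha_2 alpha_3
      map_poly_pCons pderiv_pCons map_poly_1 flip: one_pCons)

lemma der_apply_add: "der_apply (\<theta> + \<phi>) h = der_apply \<theta> h + der_apply \<phi> h"
  by (simp add: der_apply_def algebra_simps)

lemma der_apply_diff: "der_apply (\<theta> - \<phi>) h = der_apply \<theta> h - der_apply \<phi> h"
  by (simp add: der_apply_def algebra_simps)

lemma der_apply_scale: "der_apply (der_scale s \<theta>) h = s * der_apply \<theta> h"
  by (simp add: der_apply_def der_scale_def algebra_simps)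

lemma der_homogeneous_scale:
  "homogeneous m s \<Longrightarrow> der_homogeneous n \<theta> \<Longrightarrow> der_homogeneous (m + n) (der_scale s \<theta>)"
  by (simp add: der_homogeneous_def der_scale_def homogeneous_mult)

lemma der_homogeneous_diff:
  "der_homogeneous n \<theta> \<Longrightarrow> der_homogeneous n \<phi> \<Longrightarrow> der_homogeneous n (\<theta> - \<phi>)"
  by (simp add: der_homogeneous_def homogeneous_diff)

lemma homogeneous_der_apply_alpha:
  "der_homogeneous n \<theta> \<Longrightarrow> homogeneous n (der_apply \<theta> (alpha i))"
  by (cases i rule: all_3E)
    (simp_all add: der_apply_alpha der_homogeneous_def homogeneous_add)

lemma in_D_iff: "\<theta> \<in> D \<mu> \<longleftrightarrow> (\<forall>i. alpha i ^ (\<mu> $ i) dvd der_apply \<theta> (alpha i))"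
  by (simp add: D_def)

lemma D_scale: "\<theta> \<in> D \<mu> \<Longrightarrow> der_scale s \<theta> \<in> D \<mu>"
  by (simp add: in_D_iff der_apply_scale)

lemma D_add: "\<theta> \<in> D \<mu> \<Longrightarrow> \<phi> \<in> D \<mu> \<Longrightarrow> \<theta> + \<phi> \<in> D \<mu>"
  by (simp add: in_D_iff der_apply_add)

lemma D_diff: "\<theta> \<in> D \<mu> \<Longrightarrow> \<phi> \<in> D \<mu> \<Longrightarrow> \<theta> - \<phi> \<in> D \<mu>"
  by (simp add: in_D_iff der_apply_diff)

section \<open>Raising a coordinate, and the defining polynomial\<close>

definition incr :: "3 \<Rightarrow> multiplicity \<Rightarrow> multiplicity" where
  "incr i \<mu> = \<mu> + axis i 1"

lemma incr_nth [simp]: "incr i \<mu> $ j = (if j = i then Suc (\<mu> $ j) else \<mu> $ j)"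
  by (simp add: incr_def axis_def)

lemma D_incr_iff:
  "\<theta> \<in> D (incr i \<mu>) \<longleftrightarrow> \<theta> \<in> D \<mu> \<and> alpha i ^ Suc (\<mu> $ i) dvd der_apply \<theta> (alpha i)"
  unfolding in_D_iff by (auto intro: dvd_mult_right split: if_splits)

lemma D_incr_scale: "\<theta> \<in> D \<mu> \<Longrightarrow> der_scale (alpha i) \<theta> \<in> D (incr i \<mu>)"
  by (simp add: D_incr_iff D_scale der_apply_scale) (simp add: in_D_iff mult_dvd_mono)

text \<open>The defining polynomial of the multiarrangement, against which determinants of pairs in
  \<open>D \<mu>\<close> are measured.\<close>

definition Q :: "multiplicity \<Rightarrow> 'a::field S" where
  "Q \<mu> = (\<Prod>i\<in>UNIV. alpha i ^ (\<mu> $ i))"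

lemma Q_nonzero [simp]: "Q \<mu> \<noteq> 0"
  by (simp add: Q_def)

lemma Q_incr: "Q (incr i \<mu>) = alpha i * Q \<mu>"
proof -
  have "alpha j ^ ((incr i \<mu>) $ j) = (if j = i then alpha i else 1) * (alpha j ^ (\<mu> $ j) :: 'a S)"
    for j by simp
  then show ?thesis unfolding Q_def by (simp only: prod.distrib) simp
qed

lemma size_mult_incr [simp]: "size_mult (incr i \<mu>) = Suc (size_mult \<mu>)"
  by (simp add: size_mult_def incr_def sum.distrib axis_def)

lemma size_mult_3: "size_mult \<mu> = \<mu> $ 1 + \<mu> $ 2 + \<mu> $ 3"
  by (simp add: size_mult_def sum_3)

lemma homogeneous_Q: "homogeneous (size_mult \<mu>) (Q \<mu>)"
proof -
  have "homogeneous (\<Sum>i\<in>A. \<mu> $ i) (\<Prod>i\<in>A. alpha i ^ (\<mu> $ i))" for A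
  proof (induction A rule: infinite_finite_induct)
    case (insert x F)
    have "homogeneous (\<mu> $ x * 1) (alpha x ^ (\<mu> $ x))"
      by (intro homogeneous_power homogeneous_alpha)
    from homogeneous_mult[OF this insert.IH] insert.hyps show ?case by simp
  qed (simp_all add: homogeneous_1)
  then show ?thesis by (simp add: Q_def size_mult_def)
qed

lemma homogeneous_Q_multD:
  assumes "homogeneous n (Q \<mu> * u)" "u \<noteq> 0"
  shows "size_mult \<mu> \<le> n \<and> homogeneous (n - size_mult \<mu>) u"
proof -
  have "homogeneous n ((\<Prod>i\<in>A. alpha i ^ (\<mu> $ i)) * u) \<Longrightarrow>
      (\<Sum>i\<in>A. \<mu> $ i) \<le> n \<and> homogeneous (n - (\<Sum>i\<in>A. \<mu> $ i)) u" for A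
  proof (induction A arbitrary: n rule: infinite_finite_induct)
    case (insert x F)
    have "homogeneous n (alpha x ^ (\<mu> $ x) * ((\<Prod>i\<in>F. alpha i ^ (\<mu> $ i)) * u))"
      using insert by (simp add: mult.assoc)
    then have "\<mu> $ x \<le> n \<and> homogeneous (n - \<mu> $ x) ((\<Prod>i\<in>F. alpha i ^ (\<mu> $ i)) * u)"
      by (rule homogeneous_alpha_power_multD) (use assms(2) insert.hyps(1) in simp)
    with insert.IH[of "n - \<mu> $ x"] insert.hyps show ?case by auto
  qed auto
  from this[of UNIV] assms(1) show ?thesis by (simp add: Q_def size_mult_def)
qed

text \<open>The three forms are primes none of which divides another, so divisibility by each power
  can be collected factor by factor.\<close>

lemma Q_dvdI:
  fixes F :: "'a::field S"
  assumes "\<And>i. alpha i ^ (\<mu> $ i) dvd F"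
  shows "Q \<mu> dvd F"
proof -
  have "(\<Prod>i\<in>A. alpha i ^ (\<mu> $ i)) dvd F" for A
  proof (induction A rule: infinite_finite_induct)
    case (insert x A)
    obtain s where s: "F = (\<Prod>i\<in>A. alpha i ^ (\<mu> $ i)) * s"
      by (rule dvdE[OF insert.IH])
    have "\<not> alpha x dvd (\<Prod>i\<in>A. alpha i ^ (\<mu> $ i) :: 'a S)"
    proof
      assume "alpha x dvd (\<Prod>i\<in>A. alpha i ^ (\<mu> $ i) :: 'a S)"
      from prime_elem_dvd_prodD[OF prime_elem_alpha insert.hyps(1) this]
      obtain i where i: "i \<in> A" "alpha x dvd (alpha i ^ (\<mu> $ i) :: 'a S)" ..
      have "x \<noteq> i" using i(1) insert.hyps(2) by blast
      with prime_elem_dvd_power[OF prime_elem_alpha i(2)] show False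
        using alpha_not_dvd_alpha by blast
    qed
    then have "alpha x ^ (\<mu> $ x) dvd s"
      by (rule prime_elem_power_dvd_multD[OF prime_elem_alpha]) (use assms[of x] in \<open>simp only: s\<close>)
    then show ?case using insert.hyps by (simp add: s mult.commute mult_dvd_mono)
  qed simp_all
  then show ?thesis by (simp add: Q_def)
qed

section \<open>Determinants and Saito's criterion\<close>

definition der_det :: "'a::field Der \<Rightarrow> 'a Der \<Rightarrow> 'a S" where
  "der_det \<theta> \<phi> = fst \<theta> * snd \<phi> - fst \<phi> * snd \<theta>"

lemma der_det_scale_left: "der_det (der_scale s \<theta>) \<phi> = s * der_det \<theta> \<phi>"
  and der_det_scale_right: "der_det \<theta> (der_scale s \<phi>) = s * der_det \<theta> \<phi>"
  and der_det_self: "der_det \<theta> \<theta> = 0"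
  and der_det_diff_right: "der_det \<theta> (\<phi> - \<psi>) = der_det \<theta> \<phi> - der_det \<theta> \<psi>"
  and der_det_swap: "der_det \<phi> \<theta> = - der_det \<theta> \<phi>"
  by (simp_all add: der_det_def der_scale_def algebra_simps)

lemma homogeneous_der_det:
  "der_homogeneous d \<theta> \<Longrightarrow> der_homogeneous e \<phi> \<Longrightarrow> homogeneous (d + e) (der_det \<theta> \<phi>)"
  unfolding der_det_def der_homogeneous_def
  by (metis add.commute homogeneous_diff homogeneous_mult)

text \<open>A power of \<open>alpha 1\<close> or \<open>alpha 2\<close> divides a whole column of
  the coefficient matrix. For \<open>alpha 3\<close> the first column is added to the second
  beforehand, which leaves the determinant unchanged.\<close>

lemma Q_dvd_der_det:
  assumes "\<theta> \<in> D \<mu>" "\<phi> \<in> D \<mu>"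
  shows "Q \<mu> dvd der_det \<theta> \<phi>"
proof (rule Q_dvdI)
  fix i :: 3
  have h: "alpha i ^ (\<mu> $ i) dvd der_apply \<theta> (alpha i)" "alpha i ^ (\<mu> $ i) dvd der_apply \<phi> (alpha i)"
    using assms by (auto simp: in_D_iff)
  have "der_det \<theta> \<phi> = fst \<theta> * (fst \<phi> + snd \<phi>) - fst \<phi> * (fst \<theta> + snd \<theta>)"
    by (simp add: der_det_def algebra_simps)
  note * = this
  consider "i = 3" | "i = 1" | "i = 2" by (cases i rule: all_3E)
  then show "alpha i ^ (\<mu> $ i) dvd der_det \<theta> \<phi>"
  proof cases
    case 1
    then show ?thesis using h by (simp add: der_apply_alpha *)
  qed (use h in \<open>simp_all add: der_apply_alpha der_det_def\<close>)
qed

text \<open>Saito's criterion serves as the definition: the determinant condition is easy to carry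
  along when a coordinate is raised. The equivalence with homogeneous module bases is established by
  \<open>saito_basis_is_exponents\<close> and \<open>is_exponents_saito_basis\<close>.\<close>

definition saito_basis :: "multiplicity \<Rightarrow> nat \<Rightarrow> nat \<Rightarrow> 'a::field Der \<Rightarrow> 'a Der \<Rightarrow> bool" where
  "saito_basis \<mu> d e \<theta> \<phi> \<longleftrightarrow> \<theta> \<in> D \<mu> \<and> \<phi> \<in> D \<mu> \<and> der_homogeneous d \<theta> \<and> der_homogeneous e \<phi> \<and>
     (\<exists>c. c \<noteq> 0 \<and> der_det \<theta> \<phi> = cst c * Q \<mu>)"

lemma saito_basis_swap:
  assumes "saito_basis \<mu> d e \<theta> \<phi>"
  shows "saito_basis \<mu> e d \<phi> \<theta>"
proof -
  obtain c where "c \<noteq> 0" "der_det \<theta> \<phi> = cst c * Q \<mu>"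
    using assms unfolding saito_basis_def by blast
  then have "- c \<noteq> 0" "der_det \<phi> \<theta> = cst (- c) * Q \<mu>"
    by (simp_all add: der_det_swap[of \<phi> \<theta>] cst_minus)
  with assms show ?thesis unfolding saito_basis_def by blast
qed

lemma saito_basis_degrees:
  assumes "saito_basis \<mu> d e \<theta> \<phi>"
  shows "d + e = size_mult \<mu>"
proof -
  obtain c where c: "c \<noteq> 0" "der_det \<theta> \<phi> = cst c * Q \<mu>"
    using assms unfolding saito_basis_def by blast
  have "homogeneous (d + e) (der_det \<theta> \<phi>)"
    using assms by (simp add: saito_basis_def homogeneous_der_det)
  moreover have "homogeneous (0 + size_mult \<mu>) (der_det \<theta> \<phi>)"
    unfolding c(2) by (intro homogeneous_mult homogeneous_const homogeneous_Q)
  moreover have "der_det \<theta> \<phi> \<noteq> 0" using c by simp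
  ultimately show ?thesis using homogeneous_degree_unique by fastforce
qed

lemma const_poly_inverse:
  "c \<noteq> 0 \<Longrightarrow> cst (inverse c) * (cst c * f) = (f :: 'a::field S)"
  by (simp flip: mult.assoc cst_mult)

text \<open>Cramer's rule: the two numerators are determinants of elements of
  \<open>D \<mu>\<close>, hence divisible by \<open>Q \<mu>\<close>, and so the coefficients are
  polynomials. Zero coefficients are listed separately because they carry no information on
  degrees.\<close>

lemma saito_basis_decompose:
  assumes "saito_basis \<mu> d e \<theta> \<phi>" "\<psi> \<in> D \<mu>"
  obtains s t where "\<psi> = der_scale s \<theta> + der_scale t \<phi>"
    "\<And>n. der_homogeneous n \<psi> \<Longrightarrow> s = 0 \<or> d \<le> n \<and> homogeneous (n - d) s"
    "\<And>n. der_homogeneous n \<psi> \<Longrightarrow> t = 0 \<or> e \<le> n \<and> homogeneous (n - e) t"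
proof -
  obtain c where c: "c \<noteq> 0" "der_det \<theta> \<phi> = cst c * Q \<mu>"
    using assms unfolding saito_basis_def by blast
  have D: "\<theta> \<in> D \<mu>" "\<phi> \<in> D \<mu>" and h: "der_homogeneous d \<theta>" "der_homogeneous e \<phi>"
    using assms unfolding saito_basis_def by blast+
  obtain s where s: "der_det \<psi> \<phi> = Q \<mu> * s" using Q_dvd_der_det[OF assms(2) D(2)] by blast
  obtain t where t: "der_det \<theta> \<psi> = Q \<mu> * t" using Q_dvd_der_det[OF D(1) assms(2)] by blast
  define c' :: "'a S" where "c' = cst (inverse c)"
  have c': "homogeneous 0 c'" "\<And>f. c' * (cst c * f) = f"
    using const_poly_inverse[OF c(1)] by (simp_all add: c'_def homogeneous_const)
  have "der_det \<theta> \<phi> * fst \<psi> = der_det \<psi> \<phi> * fst \<theta> + der_det \<theta> \<psi> * fst \<phi>"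
    "der_det \<theta> \<phi> * snd \<psi> = der_det \<psi> \<phi> * snd \<theta> + der_det \<theta> \<psi> * snd \<phi>"
    by (simp_all add: der_det_def algebra_simps)
  then have "Q \<mu> * (cst c * fst \<psi>) = Q \<mu> * (s * fst \<theta> + t * fst \<phi>)"
    "Q \<mu> * (cst c * snd \<psi>) = Q \<mu> * (s * snd \<theta> + t * snd \<phi>)"
    unfolding s t c(2) by (simp_all only: algebra_simps)
  then have "cst c * fst \<psi> = s * fst \<theta> + t * fst \<phi>"
    "cst c * snd \<psi> = s * snd \<theta> + t * snd \<phi>"
    using mult_left_cancel[OF Q_nonzero] by blast+
  then have "fst \<psi> = c' * s * fst \<theta> + c' * t * fst \<phi>" "snd \<psi> = c' * s * snd \<theta> + c' * t * snd \<phi>"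
    using c'(2) by (metis distrib_left mult.assoc)+
  then have "\<psi> = der_scale (c' * s) \<theta> + der_scale (c' * t) \<phi>"
    by (simp add: der_scale_def prod_eq_iff)
  moreover have "c' * s = 0 \<or> d \<le> n \<and> homogeneous (n - d) (c' * s)" if n: "der_homogeneous n \<psi>" for n
  proof -
    have "s = 0 \<or> size_mult \<mu> \<le> n + e \<and> homogeneous (n + e - size_mult \<mu>) s"
      using homogeneous_Q_multD[of "n + e" \<mu> s] homogeneous_der_det[OF n h(2)] by (auto simp: s)
    then have "s = 0 \<or> d \<le> n \<and> homogeneous (n - d) s"
      by (auto simp flip: saito_basis_degrees[OF assms(1)])
    then show ?thesis using homogeneous_mult[OF c'(1)] by auto
  qed
  moreover have "c' * t = 0 \<or> e \<le> n \<and> homogeneous (n - e) (c' * t)" if n: "der_homogeneous n \<psi>" for n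
  proof -
    have "t = 0 \<or> size_mult \<mu> \<le> d + n \<and> homogeneous (d + n - size_mult \<mu>) t"
      using homogeneous_Q_multD[of "d + n" \<mu> t] homogeneous_der_det[OF h(1) n] by (auto simp: t)
    then have "t = 0 \<or> e \<le> n \<and> homogeneous (n - e) t"
      by (auto simp flip: saito_basis_degrees[OF assms(1)])
    then show ?thesis using homogeneous_mult[OF c'(1)] by auto
  qed
  ultimately show thesis using that by blast
qed

text \<open>One basis element is moved into \<open>D (incr i \<mu>)\<close> and the other is
  multiplied by \<open>alpha i\<close>, so that the determinant gains exactly the factor
  \<open>alpha i\<close>. If \<open>\<theta>\<close> does not already lie there, a multiple of it
  corrects \<open>\<phi>\<close>; \<open>d \<le> e\<close> leaves room for a multiplier of degree
  \<open>e - d\<close>.\<close>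

lemma saito_basis_step:
  assumes "saito_basis \<mu> d e \<theta> (\<phi> :: 'a::field Der)" "d \<le> e"
  shows "\<exists>d e \<theta> (\<phi> :: 'a Der). saito_basis (incr i \<mu>) d e \<theta> \<phi>"
proof -
  obtain c where c: "c \<noteq> 0" "der_det \<theta> \<phi> = cst c * Q \<mu>"
    using assms unfolding saito_basis_def by blast
  have D: "\<theta> \<in> D \<mu>" "\<phi> \<in> D \<mu>" and h: "der_homogeneous d \<theta>" "der_homogeneous e \<phi>"
    using assms unfolding saito_basis_def by blast+
  define n where "n = \<mu> $ i"
  obtain u where u: "der_apply \<theta> (alpha i) = alpha i ^ n * u"
    using D(1) unfolding in_D_iff n_def by blast
  obtain v where v: "der_apply \<phi> (alpha i) = alpha i ^ n * v"
    using D(2) unfolding in_D_iff n_def by blast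
  show ?thesis
  proof (cases "alpha i dvd u")
    case True
    then have "\<theta> \<in> D (incr i \<mu>)"
      using D u unfolding D_incr_iff n_def by (simp add: mult.commute mult_dvd_mono)
    moreover have "der_homogeneous (1 + e) (der_scale (alpha i) \<phi>)"
      by (rule der_homogeneous_scale[OF homogeneous_alpha h(2)])
    moreover have "der_det \<theta> (der_scale (alpha i) \<phi>) = cst c * Q (incr i \<mu>)"
      by (simp only: der_det_scale_right c(2) Q_incr mult_ac)
    ultimately show ?thesis
      using c(1) D h D_incr_scale[OF D(2)] unfolding saito_basis_def by metis
  next
    case False
    have "u \<noteq> 0" using False by auto
    then have n: "n \<le> d" and hu: "homogeneous (d - n) u"
      using homogeneous_alpha_power_multD[of d i n u] homogeneous_der_apply_alpha[OF h(1), of i]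
      by (simp_all add: u)
    \<comment> \<open>Modulo \<open>alpha i\<close>, both \<open>u\<close> and \<open>v\<close> are
      scalar multiples of powers of \<open>tform i\<close>, and the scalar of \<open>u\<close> is
      nonzero, so \<open>v\<close> can be divided by \<open>u\<close> on the line.\<close>
    have "\<exists>s. homogeneous (e - d) s \<and> alpha i dvd v - s * u"
    proof (cases "v = 0")
      case True
      then show ?thesis by (intro exI[of _ 0]) simp
    next
      case v0: False
      have hv: "homogeneous (e - n) v"
        using homogeneous_alpha_power_multD[of e i n v] homogeneous_der_apply_alpha[OF h(2), of i] v0
        by (simp add: v)
      obtain a where a: "alpha i dvd u - cst a * tform i ^ (d - n)"
        using homogeneous_mod_alpha[OF hu] by blast
      obtain b where b: "alpha i dvd v - cst b * tform i ^ (e - n)"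
        using homogeneous_mod_alpha[OF hv] by blast
      have "a \<noteq> 0" using a False by auto
      define s where "s = cst (b / a) * tform i ^ (e - d)"
      have "homogeneous (0 + (e - d) * 1) s" unfolding s_def
        by (intro homogeneous_mult homogeneous_const homogeneous_power homogeneous_tform)
      moreover have "alpha i dvd v - s * u"
      proof -
        have "s * (cst a * tform i ^ (d - n)) =
            (cst (b / a) * cst a) * (tform i ^ (e - d) * tform i ^ (d - n))"
          by (simp only: s_def mult_ac)
        also have "\<dots> = cst b * tform i ^ (e - n)"
          using \<open>a \<noteq> 0\<close> n assms(2) by (simp flip: power_add cst_mult)
        finally have "v - s * u = (v - cst b * tform i ^ (e - n))
            - s * (u - cst a * tform i ^ (d - n))"
          by (simp add: right_diff_distrib)
        then show ?thesis using dvd_diff[OF b dvd_mult[OF a]] by (simp only:)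
      qed
      ultimately show ?thesis by auto
    qed
    then obtain s where s: "homogeneous (e - d) s" "alpha i dvd v - s * u" by blast
    define \<psi> where "\<psi> = \<phi> - der_scale s \<theta>"
    have "der_apply \<psi> (alpha i) = alpha i ^ n * (v - s * u)"
      by (simp add: \<psi>_def der_apply_diff der_apply_scale u v algebra_simps)
    moreover have "\<psi> \<in> D \<mu>" unfolding \<psi>_def by (intro D_diff D D_scale)
    ultimately have "\<psi> \<in> D (incr i \<mu>)"
      using s(2) unfolding D_incr_iff n_def by (simp add: mult.commute mult_dvd_mono)
    moreover have "der_homogeneous e \<psi>"
      using der_homogeneous_diff[OF h(2)] der_homogeneous_scale[OF s(1) h(1)] assms(2)
      by (simp add: \<psi>_def)
    moreover have "der_homogeneous (1 + d) (der_scale (alpha i) \<theta>)"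
      by (rule der_homogeneous_scale[OF homogeneous_alpha h(1)])
    moreover have "der_det (der_scale (alpha i) \<theta>) \<psi> = cst c * Q (incr i \<mu>)"
      by (simp add: der_det_scale_left der_det_scale_right der_det_diff_right der_det_self \<psi>_def
          c(2) Q_incr)
    ultimately show ?thesis
      using c(1) D_incr_scale[OF D(1)] unfolding saito_basis_def by metis
  qed
qed

lemma multiplicity_induct [case_names zero step]:
  fixes \<mu> :: multiplicity
  assumes "P 0" "\<And>\<mu> i. P \<mu> \<Longrightarrow> P (incr i \<mu>)"
  shows "P \<mu>"
proof (induction "size_mult \<mu>" arbitrary: \<mu>)
  case 0
  then have "\<mu> = 0" by (simp add: size_mult_def vec_eq_iff)
  then show ?case using assms by simp
next
  case (Suc n)
  have "\<exists>i. \<mu> $ i \<noteq> 0"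
  proof (rule ccontr)
    assume "\<not> ?thesis"
    then have "size_mult \<mu> = 0" by (simp add: size_mult_def)
    with Suc show False by simp
  qed
  then obtain i where i: "\<mu> $ i \<noteq> 0" by blast
  define \<nu> where "\<nu> = \<mu> - axis i 1"
  have e: "\<mu> = incr i \<nu>" using i by (auto simp: \<nu>_def vec_eq_iff axis_def)
  have "n = size_mult \<nu>" using Suc.hyps(2) unfolding e by simp
  then have "P \<nu>" using Suc.hyps(1) by blast
  then show ?case using assms(2) e by simp
qed

text \<open>The coordinates are raised one by one from 0, where the two partial derivatives form a
  basis; swapping restores the order of degrees that each step requires.\<close>

lemma saito_basis_exists:
  obtains d e and \<theta> \<phi> :: "'a::field Der" where "saito_basis \<mu> d e \<theta> \<phi>" "d \<le> e"
proof -
  have "\<exists>d e \<theta> (\<phi> :: 'a Der). saito_basis \<mu> d e \<theta> \<phi>"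
  proof (induction \<mu> rule: multiplicity_induct)
    case zero
    have "saito_basis 0 0 0 (1, 0) (0, 1 :: 'a S)"
      unfolding saito_basis_def
      by (auto simp: in_D_iff der_homogeneous_def homogeneous_1 der_det_def Q_def intro!: exI[of _ 1])
    then show ?case by blast
  next
    case (step \<mu> i)
    then obtain d e and \<theta> \<phi> :: "'a Der" where b: "saito_basis \<mu> d e \<theta> \<phi>" by blast
    show ?case
    proof (cases "d \<le> e")
      case True
      then show ?thesis using saito_basis_step[OF b] by blast
    next
      case False
      then show ?thesis using saito_basis_step[OF saito_basis_swap[OF b]] by auto
    qed
  qed
  then obtain d e and \<theta> \<phi> :: "'a Der" where b: "saito_basis \<mu> d e \<theta> \<phi>" by blast
  show thesis
  proof (cases "d \<le> e")
    case True
    then show ?thesis using that b by blast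
  next
    case False
    then show ?thesis using that[OF saito_basis_swap[OF b]] by simp
  qed
qed

section \<open>Least degrees and valleys\<close>

text \<open>This is the smaller exponent. As a minimum over single elements it is bounded above by
  exhibiting one derivation, without completing it to a basis.\<close>

definition mdeg :: "'a::field itself \<Rightarrow> multiplicity \<Rightarrow> nat" where
  "mdeg F \<mu> = (LEAST n. \<exists>\<psi>. \<psi> \<in> D \<mu> \<and> (\<psi> :: 'a Der) \<noteq> 0 \<and> der_homogeneous n \<psi>)"

lemma mdeg_le:
  fixes \<psi> :: "'a::field Der"
  assumes "\<psi> \<in> D \<mu>" "\<psi> \<noteq> 0" "der_homogeneous n \<psi>"
  shows "mdeg TYPE('a) \<mu> \<le> n"
  unfolding mdeg_def using assms by (intro Least_le) blast

lemma saito_basis_nonzero: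
  assumes "saito_basis \<mu> d e \<theta> \<phi>"
  shows "\<theta> \<noteq> 0" "\<phi> \<noteq> 0"
  using assms by (auto simp: saito_basis_def der_det_def)

lemma saito_basis_mdeg:
  fixes \<theta> \<phi> :: "'a::field Der"
  assumes b: "saito_basis \<mu> d e \<theta> \<phi>" "d \<le> e"
  shows "mdeg TYPE('a) \<mu> = d"
  unfolding mdeg_def
proof (rule Least_equality)
  show "\<exists>\<psi>. \<psi> \<in> D \<mu> \<and> (\<psi> :: 'a Der) \<noteq> 0 \<and> der_homogeneous d \<psi>"
    using b saito_basis_nonzero(1)[OF b(1)] unfolding saito_basis_def by blast
  fix n assume "\<exists>\<psi>. \<psi> \<in> D \<mu> \<and> (\<psi> :: 'a Der) \<noteq> 0 \<and> der_homogeneous n \<psi>"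
  then obtain \<psi> :: "'a Der" where \<psi>: "\<psi> \<in> D \<mu>" "\<psi> \<noteq> 0" "der_homogeneous n \<psi>" by blast
  obtain s t where st: "\<psi> = der_scale s \<theta> + der_scale t \<phi>"
    "s = 0 \<or> d \<le> n" "t = 0 \<or> e \<le> n"
    using saito_basis_decompose[OF b(1) \<psi>(1)] \<psi>(3) by metis
  then show "d \<le> n" using \<psi>(2) b(2) by (auto simp: der_scale_def prod_eq_iff)
qed

lemma mdeg_obtain:
  obtains \<psi> :: "'a::field Der"
  where "\<psi> \<in> D \<mu>" "\<psi> \<noteq> 0" "der_homogeneous (mdeg TYPE('a) \<mu>) \<psi>"
proof -
  obtain d e and \<theta> \<phi> :: "'a Der" where b: "saito_basis \<mu> d e \<theta> \<phi>" "d \<le> e"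
    by (rule saito_basis_exists)
  show thesis
    using that[of \<theta>] b saito_basis_nonzero(1)[OF b(1)] saito_basis_mdeg[OF b]
    unfolding saito_basis_def by blast
qed

lemma two_mdeg_le: "2 * mdeg TYPE('a::field) \<mu> \<le> size_mult \<mu>"
proof -
  obtain d e and \<theta> \<phi> :: "'a Der" where b: "saito_basis \<mu> d e \<theta> \<phi>" "d \<le> e"
    by (rule saito_basis_exists)
  show ?thesis using saito_basis_mdeg[OF b] saito_basis_degrees[OF b(1)] b(2) by simp
qed

text \<open>When the exponents differ, the second basis element has too large a degree to contribute
  in the lowest degree, and the coefficient of the first has degree 0. This rigidity drives all the
  valley arguments.\<close>

lemma mdeg_proportional:
  fixes \<psi> \<psi>' :: "'a::field Der"
  assumes lt: "2 * mdeg TYPE('a) \<mu> < size_mult \<mu>"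
    and \<psi>: "\<psi> \<in> D \<mu>" "\<psi> \<noteq> 0" "der_homogeneous (mdeg TYPE('a) \<mu>) \<psi>"
    and \<psi>': "\<psi>' \<in> D \<mu>" "der_homogeneous (mdeg TYPE('a) \<mu>) \<psi>'"
  obtains c where "\<psi>' = der_scale (cst c) \<psi>"
proof -
  obtain d e and \<theta> \<phi> :: "'a Der" where b: "saito_basis \<mu> d e \<theta> \<phi>" "d \<le> e"
    by (rule saito_basis_exists)
  have d: "mdeg TYPE('a) \<mu> = d" by (rule saito_basis_mdeg[OF b])
  have e: "d < e" using saito_basis_degrees[OF b(1)] lt d by simp
  have "\<exists>c. \<omega> = der_scale (cst c) \<theta>" if \<omega>: "\<omega> \<in> D \<mu>" "der_homogeneous d \<omega>" for \<omega>
  proof -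
    obtain s t where st: "\<omega> = der_scale s \<theta> + der_scale t \<phi>"
      "s = 0 \<or> d \<le> d \<and> homogeneous (d - d) s" "t = 0 \<or> e \<le> d \<and> homogeneous (d - e) t"
      using saito_basis_decompose[OF b(1) \<omega>(1)] \<omega>(2) by metis
    have "t = 0" using st(3) e by auto
    moreover have "homogeneous 0 s" using st(2) by auto
    then obtain c where "s = cst c" by (rule homogeneous_0_obtain)
    ultimately have "\<omega> = der_scale (cst c) \<theta>" using st(1) by (simp add: der_scale_def prod_eq_iff)
    then show ?thesis by blast
  qed
  then obtain a a' where a: "\<psi> = der_scale (cst a) \<theta>" "\<psi>' = der_scale (cst a') \<theta>"
    using \<psi> \<psi>' d by metis
  have "a \<noteq> 0" using \<psi>(2) a(1) by (auto simp: der_scale_def prod_eq_iff)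
  then have "\<psi>' = der_scale (cst (a' / a)) \<psi>"
    by (simp add: a der_scale_def flip: mult.assoc cst_mult)
  then show thesis by (rule that)
qed

section \<open>Exponents and their difference\<close>

lemma saito_basis_is_exponents:
  fixes \<theta> \<phi> :: "'a::field Der"
  assumes b: "saito_basis \<mu> d e \<theta> \<phi>"
  shows "is_exponents TYPE('a) \<mu> d e"
proof -
  interpret module "der_scale :: 'a S \<Rightarrow> 'a Der \<Rightarrow> 'a Der" by (rule module_der_scale)
  have det: "der_det \<theta> \<phi> \<noteq> 0" using b unfolding saito_basis_def by auto
  then have ne: "\<theta> \<noteq> \<phi>" using der_det_self by metis
  have D: "\<theta> \<in> D \<mu>" "\<phi> \<in> D \<mu>" and h: "der_homogeneous d \<theta>" "der_homogeneous e \<phi>"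
    using b unfolding saito_basis_def by blast+
  have "subspace (D \<mu> :: 'a Der set)"
    unfolding subspace_def by (auto intro: D_add D_scale) (simp add: in_D_iff der_apply_def)
  then have "span {\<theta>, \<phi>} \<subseteq> D \<mu>" using D by (intro span_minimal) auto
  moreover have "D \<mu> \<subseteq> span {\<theta>, \<phi>}"
  proof
    fix \<psi> :: "'a Der" assume "\<psi> \<in> D \<mu>"
    then obtain s t where "\<psi> = der_scale s \<theta> + der_scale t \<phi>"
      using saito_basis_decompose[OF b] by metis
    then show "\<psi> \<in> span {\<theta>, \<phi>}" by (simp add: span_add span_scale span_base)
  qed
  moreover have "\<not> dependent {\<theta>, \<phi>}"
  proof
    assume "dependent {\<theta>, \<phi>}"
    then obtain u where u: "u \<theta> \<noteq> 0 \<or> u \<phi> \<noteq> 0" "der_scale (u \<theta>) \<theta> + der_scale (u \<phi>) \<phi> = 0"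
      using ne by (auto simp: dependent_finite)
    \<comment> \<open>Pairing a linear relation with either basis element isolates one coefficient
      times the nonzero determinant.\<close>
    have "u \<theta> * der_det \<theta> \<phi> = der_det (der_scale (u \<theta>) \<theta> + der_scale (u \<phi>) \<phi>) \<phi>"
      "u \<phi> * der_det \<theta> \<phi> = der_det \<theta> (der_scale (u \<theta>) \<theta> + der_scale (u \<phi>) \<phi>)"
      by (simp_all add: der_det_def der_scale_def algebra_simps)
    with u det show False by (simp add: der_det_def)
  qed
  ultimately show ?thesis using ne h unfolding is_exponents_def by blast
qed

text \<open>An existing Saito basis is expressed through the given one. Determinants multiply, so
  the cofactor \<open>s\<close> of \<open>Q \<mu>\<close> divides a nonzero constant, and units of
  the polynomial ring are nonzero constants.\<close>

lemma is_exponents_saito_basis: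
  assumes "is_exponents TYPE('a::field) \<mu> d e"
  obtains \<theta> \<phi> :: "'a::field Der" where "saito_basis \<mu> d e \<theta> \<phi>"
proof -
  interpret module "der_scale :: 'a S \<Rightarrow> 'a Der \<Rightarrow> 'a Der" by (rule module_der_scale)
  obtain \<theta> \<phi> :: "'a Der" where b: "span {\<theta>, \<phi>} = D \<mu>" "der_homogeneous d \<theta>" "der_homogeneous e \<phi>"
    using assms unfolding is_exponents_def by blast
  have D: "\<theta> \<in> D \<mu>" "\<phi> \<in> D \<mu>" using span_base[of _ "{\<theta>, \<phi>}"] b(1) by simp_all
  obtain s where s: "der_det \<theta> \<phi> = Q \<mu> * s" using Q_dvd_der_det[OF D] by blast
  obtain d' e' and \<theta>' \<phi>' :: "'a Der" where b': "saito_basis \<mu> d' e' \<theta>' \<phi>'" "d' \<le> e'"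
    by (rule saito_basis_exists)
  obtain c where c: "c \<noteq> 0" "der_det \<theta>' \<phi>' = cst c * Q \<mu>"
    using b' unfolding saito_basis_def by blast
  have "\<exists>p q. \<omega> = der_scale p \<theta> + der_scale q \<phi>" if "\<omega> \<in> D \<mu>" for \<omega>
  proof -
    have "\<omega> \<in> span {\<theta>, \<phi>}" using that b(1) by simp
    then obtain p q where "\<omega> - der_scale p \<theta> = der_scale q \<phi>"
      unfolding span_breakdown_eq span_singleton by auto
    then have "\<omega> = der_scale p \<theta> + der_scale q \<phi>" by (simp add: algebra_simps)
    then show ?thesis by blast
  qed
  moreover have "\<theta>' \<in> D \<mu>" "\<phi>' \<in> D \<mu>" using b'(1) unfolding saito_basis_def by blast+
  ultimately obtain p q p' q' where pq: "\<theta>' = der_scale p \<theta> + der_scale q \<phi>"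
    "\<phi>' = der_scale p' \<theta> + der_scale q' \<phi>" by metis
  have "der_det \<theta>' \<phi>' = (p * q' - p' * q) * der_det \<theta> \<phi>"
    by (simp add: pq der_det_def der_scale_def algebra_simps)
  then have "Q \<mu> * cst c = Q \<mu> * (s * (p * q' - p' * q))" by (simp add: c s mult_ac)
  then have "cst c = s * (p * q' - p' * q)" using mult_left_cancel[OF Q_nonzero] by blast
  then have "1 = s * ((p * q' - p' * q) * cst (inverse c))"
    using c(1) by (metis cst_mult cst_1 mult.assoc right_inverse)
  then have "s dvd 1" by (rule dvdI)
  then obtain a where a: "s = [:a:]" "a dvd 1" by (auto simp: is_unit_poly_iff)
  then obtain a' where a': "a = [:a':]" "a' dvd 1" by (auto simp: is_unit_poly_iff)
  have "a' \<noteq> 0" using a'(2) by auto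
  moreover have "der_det \<theta> \<phi> = cst a' * Q \<mu>" by (simp add: s a a' cst_def)
  ultimately have "saito_basis \<mu> d e \<theta> \<phi>" using D b unfolding saito_basis_def by blast
  then show thesis by (rule that)
qed

lemma Delta_eq: "Delta TYPE('a::field) \<mu> = size_mult \<mu> - 2 * mdeg TYPE('a) \<mu>"
  unfolding Delta_def
proof (rule the_equality)
  obtain d e and \<theta> \<phi> :: "'a Der" where b: "saito_basis \<mu> d e \<theta> \<phi>" "d \<le> e"
    by (rule saito_basis_exists)
  have "size_mult \<mu> - 2 * mdeg TYPE('a) \<mu> = nat \<bar>int d - int e\<bar>"
    using saito_basis_mdeg[OF b] saito_basis_degrees[OF b(1)] b(2) by simp
  then show "\<exists>d1 d2. is_exponents TYPE('a) \<mu> d1 d2 \<and>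
      size_mult \<mu> - 2 * mdeg TYPE('a) \<mu> = nat \<bar>int d1 - int d2\<bar>"
    using saito_basis_is_exponents[OF b(1)] by blast
next
  fix n assume "\<exists>d1 d2. is_exponents TYPE('a) \<mu> d1 d2 \<and> n = nat \<bar>int d1 - int d2\<bar>"
  then obtain d e where de: "is_exponents TYPE('a) \<mu> d e" "n = nat \<bar>int d - int e\<bar>" by blast
  obtain \<theta> \<phi> :: "'a Der" where b: "saito_basis \<mu> d e \<theta> \<phi>"
    by (rule is_exponents_saito_basis[OF de(1)])
  show "n = size_mult \<mu> - 2 * mdeg TYPE('a) \<mu>"
  proof (cases "d \<le> e")
    case True
    then show ?thesis using saito_basis_mdeg[OF b] saito_basis_degrees[OF b] de(2) by simp
  next
    case False
    then have "mdeg TYPE('a) \<mu> = e" using saito_basis_mdeg[OF saito_basis_swap[OF b]] by simp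
    then show ?thesis using False saito_basis_degrees[OF b] de(2) by simp
  qed
qed

lemma size_mult_Delta:
  "size_mult \<mu> = 2 * mdeg TYPE('a::field) \<mu> + Delta TYPE('a) \<mu>"
  using two_mdeg_le[where 'a = 'a] by (simp add: Delta_eq)

text \<open>\<open>D (incr i \<mu>)\<close> is contained in \<open>D \<mu>\<close> and contains its
  multiples by \<open>alpha i\<close>.\<close>

lemma mdeg_incr: "mdeg TYPE('a::field) \<mu> \<le> mdeg TYPE('a) (incr i \<mu>)"
  "mdeg TYPE('a) (incr i \<mu>) \<le> Suc (mdeg TYPE('a) \<mu>)"
proof -
  obtain \<psi> :: "'a Der" where \<psi>: "\<psi> \<in> D (incr i \<mu>)" "\<psi> \<noteq> 0"
      "der_homogeneous (mdeg TYPE('a) (incr i \<mu>)) \<psi>"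
    by (rule mdeg_obtain)
  then show "mdeg TYPE('a::field) \<mu> \<le> mdeg TYPE('a) (incr i \<mu>)"
    using mdeg_le D_incr_iff by blast
  obtain \<theta> :: "'a Der" where \<theta>: "\<theta> \<in> D \<mu>" "\<theta> \<noteq> 0" "der_homogeneous (mdeg TYPE('a) \<mu>) \<theta>"
    by (rule mdeg_obtain)
  have "der_scale (alpha i) \<theta> \<noteq> 0" using \<theta>(2) by (auto simp: der_scale_def prod_eq_iff)
  then show "mdeg TYPE('a) (incr i \<mu>) \<le> Suc (mdeg TYPE('a) \<mu>)"
    using mdeg_le[OF D_incr_scale[OF \<theta>(1)] _ der_homogeneous_scale[OF homogeneous_alpha \<theta>(3)]]
    by simp
qed

text \<open>The size grows by one while twice the least degree grows by 0 or 2, so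
  \<open>Delta\<close> can never stay constant along a step.\<close>

lemma Delta_incr:
  "Delta TYPE('a::field) (incr i \<mu>) = Suc (Delta TYPE('a) \<mu>) \<or>
   Delta TYPE('a) \<mu> = Suc (Delta TYPE('a) (incr i \<mu>))"
proof -
  consider "mdeg TYPE('a) (incr i \<mu>) = mdeg TYPE('a) \<mu>"
    | "mdeg TYPE('a) (incr i \<mu>) = Suc (mdeg TYPE('a) \<mu>)"
    using mdeg_incr(1)[where 'a = 'a, of \<mu> i] mdeg_incr(2)[where 'a = 'a, of i \<mu>]
    by linarith
  then show ?thesis
    using size_mult_Delta[where 'a = 'a, of \<mu>] size_mult_Delta[where 'a = 'a, of "incr i \<mu>"]
    unfolding size_mult_incr by cases linarith+
qed

lemma mdeg_incr_Delta_down: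
  assumes "Delta TYPE('a::field) \<mu> = Suc (Delta TYPE('a) (incr i \<mu>))"
  shows "mdeg TYPE('a) (incr i \<mu>) = Suc (mdeg TYPE('a) \<mu>)"
  using size_mult_Delta[where 'a = 'a, of \<mu>] size_mult_Delta[where 'a = 'a, of "incr i \<mu>"] assms
  unfolding size_mult_incr by linarith

lemma mdeg_incr_Delta_up:
  assumes "Delta TYPE('a::field) (incr i \<mu>) = Suc (Delta TYPE('a) \<mu>)"
  shows "mdeg TYPE('a) (incr i \<mu>) = mdeg TYPE('a) \<mu>"
  using size_mult_Delta[where 'a = 'a, of \<mu>] size_mult_Delta[where 'a = 'a, of "incr i \<mu>"] assms
  unfolding size_mult_incr by linarith

lemma der_scale_eq_0_iff [simp]: "der_scale s \<theta> = 0 \<longleftrightarrow> s = 0 \<or> \<theta> = 0"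
  by (auto simp: der_scale_def prod_eq_iff)

text \<open>In the next three lemmas, uniqueness up to constants of the derivation of lowest degree
  where \<open>Delta = k > 0\<close> excludes that \<open>Delta\<close> rises again beyond such a point.\<close>

lemma Delta_valley_line:
  assumes "0 < k" "Delta TYPE('a::field) \<mu> = Suc k" "Delta TYPE('a) (incr i \<mu>) = k"
  shows "Delta TYPE('a) (incr i (incr i \<mu>)) \<noteq> Suc k"
proof
  assume top: "Delta TYPE('a) (incr i (incr i \<mu>)) = Suc k"
  define d where "d = mdeg TYPE('a) \<mu>"
  note sz = size_mult_Delta[where 'a = 'a]
  have m1: "mdeg TYPE('a) (incr i \<mu>) = Suc d" and m2: "mdeg TYPE('a) (incr i (incr i \<mu>)) = Suc d"
    using mdeg_incr_Delta_down[of \<mu> i] mdeg_incr_Delta_up[of i "incr i \<mu>"] assms top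
    by (metis d_def)+
  obtain \<theta> :: "'a Der" where \<theta>: "\<theta> \<in> D \<mu>" "\<theta> \<noteq> 0" "der_homogeneous d \<theta>"
    unfolding d_def by (rule mdeg_obtain)
  obtain \<psi> :: "'a Der" where \<psi>: "\<psi> \<in> D (incr i (incr i \<mu>))" "\<psi> \<noteq> 0" "der_homogeneous (Suc d) \<psi>"
    using mdeg_obtain[where 'a = 'a, of "incr i (incr i \<mu>)"] unfolding m2 by blast
  have \<psi>': "\<psi> \<in> D (incr i \<mu>)" using \<psi>(1) D_incr_iff by blast
  have lt: "2 * mdeg TYPE('a) (incr i \<mu>) < size_mult (incr i \<mu>)"
    using sz[of "incr i \<mu>"] assms(1,3) by simp
  obtain c where c: "\<psi> = der_scale (cst c) (der_scale (alpha i) \<theta>)"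
    using mdeg_proportional[OF lt D_incr_scale[OF \<theta>(1)] _ _ \<psi>'] \<theta> \<psi>(3)
      der_homogeneous_scale[OF homogeneous_alpha \<theta>(3), of i] by (auto simp: m1)
  then have "c \<noteq> 0" using \<psi>(2) by auto
  \<comment> \<open>Cancelling the constant and one factor \<open>alpha i\<close> puts
    \<open>\<theta>\<close> itself into \<open>D (incr i \<mu>)\<close>, in a degree below the
    minimum \<open>Suc d\<close> there.\<close>
  have "alpha i * alpha i ^ Suc (\<mu> $ i) dvd cst c * (alpha i * der_apply \<theta> (alpha i))"
    using \<psi>(1) unfolding D_incr_iff c by (simp add: der_apply_scale)
  then have "alpha i * alpha i ^ Suc (\<mu> $ i) dvd cst (inverse c) * (cst c * (alpha i * der_apply \<theta> (alpha i)))"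
    by (rule dvd_mult)
  then have "alpha i ^ Suc (\<mu> $ i) dvd der_apply \<theta> (alpha i)"
    unfolding const_poly_inverse[OF \<open>c \<noteq> 0\<close>] by (metis alpha_nonzero dvd_mult_cancel_left)
  then have "\<theta> \<in> D (incr i \<mu>)" using \<theta>(1) D_incr_iff by blast
  then show False using mdeg_le[OF _ \<theta>(2,3)] m1 by fastforce
qed

lemma Delta_valley_square:
  assumes "i \<noteq> j" "0 < k" "Delta TYPE('a::field) \<mu> = Suc k"
    "Delta TYPE('a) (incr i \<mu>) = k" "Delta TYPE('a) (incr j \<mu>) = k"
  shows "Delta TYPE('a) (incr i (incr j \<mu>)) \<noteq> Suc k"
proof
  assume top: "Delta TYPE('a) (incr i (incr j \<mu>)) = Suc k"
  define d where "d = mdeg TYPE('a) \<mu>"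
  note sz = size_mult_Delta[where 'a = 'a]
  have m: "mdeg TYPE('a) (incr i \<mu>) = Suc d" "mdeg TYPE('a) (incr j \<mu>) = Suc d"
    "mdeg TYPE('a) (incr i (incr j \<mu>)) = Suc d"
    using mdeg_incr_Delta_down[of \<mu> i] mdeg_incr_Delta_down[of \<mu> j]
      mdeg_incr_Delta_up[of i "incr j \<mu>"] assms(3-5) top
    by (metis d_def)+
  obtain \<theta> :: "'a Der" where \<theta>: "\<theta> \<in> D \<mu>" "\<theta> \<noteq> 0" "der_homogeneous d \<theta>"
    unfolding d_def by (rule mdeg_obtain)
  obtain \<psi> :: "'a Der" where \<psi>: "\<psi> \<in> D (incr i (incr j \<mu>))" "\<psi> \<noteq> 0" "der_homogeneous (Suc d) \<psi>"
    using mdeg_obtain[where 'a = 'a, of "incr i (incr j \<mu>)"] unfolding m(3) by blast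
  have \<psi>j: "\<psi> \<in> D (incr j \<mu>)" using \<psi>(1) D_incr_iff by blast
  then have \<psi>i: "\<psi> \<in> D (incr i \<mu>)" using \<psi>(1) assms(1) by (simp add: D_incr_iff)
  have lt: "2 * mdeg TYPE('a) (incr i \<mu>) < size_mult (incr i \<mu>)"
    "2 * mdeg TYPE('a) (incr j \<mu>) < size_mult (incr j \<mu>)"
    using sz[of "incr i \<mu>"] sz[of "incr j \<mu>"] assms(2,4,5) by simp_all
  have h: "der_homogeneous (Suc d) (der_scale (alpha l) \<theta>)" for l
    using der_homogeneous_scale[OF homogeneous_alpha \<theta>(3), of l] by simp
  obtain a where a: "der_scale (alpha i) \<theta> = der_scale (cst a) \<psi>"
    using mdeg_proportional[OF lt(1) \<psi>i \<psi>(2) _ D_incr_scale[OF \<theta>(1)]] \<psi>(3) h m by metis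
  obtain b where b: "der_scale (alpha j) \<theta> = der_scale (cst b) \<psi>"
    using mdeg_proportional[OF lt(2) \<psi>j \<psi>(2) _ D_incr_scale[OF \<theta>(1)]] \<psi>(3) h m by metis
  have "b \<noteq> 0"
  proof
    assume "b = 0"
    then have "der_scale (alpha j) \<theta> = 0" unfolding b by simp
    then show False using \<theta>(2) by simp
  qed
  \<comment> \<open>Eliminating \<open>\<psi>\<close> between the relations \<open>a\<close> and
    \<open>b\<close> would make two of the linear forms proportional.\<close>
  have "der_scale (cst b * alpha i) \<theta> = der_scale (cst b) (der_scale (alpha i) \<theta>)"
    by (simp add: der_scale_def mult.assoc)
  also have "\<dots> = der_scale (cst a) (der_scale (alpha j) \<theta>)"
    unfolding a b by (simp add: der_scale_def mult_ac)
  also have "\<dots> = der_scale (cst a * alpha j) \<theta>"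
    by (simp add: der_scale_def mult.assoc)
  finally have "der_scale (cst b * alpha i - cst a * alpha j) \<theta> = 0"
    by (simp add: der_scale_def left_diff_distrib prod_eq_iff)
  then have "cst b * alpha i = cst a * alpha j" using \<theta>(2) by simp
  then have "alpha i = (cst (inverse b) * cst a) * alpha j"
    using const_poly_inverse[OF \<open>b \<noteq> 0\<close>, of "alpha i"] by (simp add: mult.assoc)
  then have "alpha j dvd (alpha i :: 'a S)" by (metis dvd_triv_right)
  then show False using alpha_not_dvd_alpha assms(1) by metis
qed

lemma Delta_valley_diagonal:
  assumes "i \<noteq> j" "0 < k" "Delta TYPE('a::field) \<mu> = k"
    "Delta TYPE('a) (incr i \<mu>) = Suc k" "Delta TYPE('a) (incr i (incr j \<mu>)) = k"
  shows "Delta TYPE('a) (incr j \<mu>) \<noteq> Suc k"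
proof
  assume dj: "Delta TYPE('a) (incr j \<mu>) = Suc k"
  define d where "d = mdeg TYPE('a) \<mu>"
  note sz = size_mult_Delta[where 'a = 'a]
  have m: "mdeg TYPE('a) (incr i \<mu>) = d" "mdeg TYPE('a) (incr j \<mu>) = d"
    "mdeg TYPE('a) (incr i (incr j \<mu>)) = Suc d"
    using mdeg_incr_Delta_up[of i \<mu>] mdeg_incr_Delta_up[of j \<mu>]
      mdeg_incr_Delta_down[of "incr j \<mu>" i] assms(3-5) dj
    by (metis d_def)+
  obtain \<theta> :: "'a Der" where \<theta>: "\<theta> \<in> D (incr i \<mu>)" "\<theta> \<noteq> 0" "der_homogeneous d \<theta>"
    using mdeg_obtain[where 'a = 'a, of "incr i \<mu>"] unfolding m by blast
  obtain \<psi> :: "'a Der" where \<psi>: "\<psi> \<in> D (incr j \<mu>)" "\<psi> \<noteq> 0" "der_homogeneous d \<psi>"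
    using mdeg_obtain[where 'a = 'a, of "incr j \<mu>"] unfolding m by blast
  \<comment> \<open>Degree \<open>d\<close> is minimal at \<open>\<mu>\<close> too, so
    \<open>\<theta>\<close> and \<open>\<psi>\<close> are proportional. Then \<open>\<theta>\<close>
    satisfies both raised conditions in a degree below the minimum \<open>Suc d\<close> at the upper
    corner.\<close>
  have "\<theta> \<in> D \<mu>" "\<psi> \<in> D \<mu>" using \<theta>(1) \<psi>(1) D_incr_iff by blast+
  moreover have "2 * mdeg TYPE('a) \<mu> < size_mult \<mu>" using sz[of \<mu>] assms(2,3) by simp
  ultimately obtain c where "\<theta> = der_scale (cst c) \<psi>"
    using mdeg_proportional \<theta>(3) \<psi>(2,3) unfolding d_def by metis
  then have "\<theta> \<in> D (incr j \<mu>)" using D_scale[OF \<psi>(1)] by simp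
  then have "\<theta> \<in> D (incr i (incr j \<mu>))" using \<theta>(1) assms(1) by (simp add: D_incr_iff)
  then show False using mdeg_le[OF _ \<theta>(2,3)] m(3) by fastforce
qed

section \<open>Frobenius and derivatives\<close>

text \<open>Translation by 1 permutes the field, so comparing the sums of all elements before and
  after shows that the cardinality vanishes in the field.\<close>

lemma CHAR_eq_prime_CARD:
  assumes "prime p" "CARD('a::field) = p"
  shows "CHAR('a) = p"
proof -
  have fin: "finite (UNIV :: 'a set)"
    using assms card.infinite not_prime_0 by metis
  have "(\<Sum>x\<in>UNIV. x + 1) = (\<Sum>x\<in>UNIV. x :: 'a)"
    by (rule sum.reindex_bij_betw[of "\<lambda>x. x + 1" UNIV UNIV "\<lambda>x. x"])
      (rule bij_betwI[of _ _ _ "\<lambda>x. x - 1"], auto)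
  then have "of_nat p = (0 :: 'a)"
    by (simp add: sum.distrib assms(2))
  then have "CHAR('a) dvd p" by (simp add: of_nat_eq_0_iff_char_dvd)
  then show ?thesis using assms(1) CHAR_not_1' by (metis One_nat_def prime_nat_iff)
qed

definition der_power :: "nat \<Rightarrow> 'a::field Der \<Rightarrow> 'a Der" where
  "der_power n \<theta> = (fst \<theta> ^ n, snd \<theta> ^ n)"

lemma der_apply_frobenius:
  fixes \<theta> :: "'a::field Der"
  assumes "prime p" "CHAR('a) = p"
  shows "der_apply (der_power p \<theta>) (alpha i) = der_apply \<theta> (alpha i) ^ p"
proof -
  have "(fst \<theta> + snd \<theta>) ^ p = fst \<theta> ^ p + snd \<theta> ^ p"
    using assms by (intro freshmans_dream) simp_all
  then show ?thesis
    by (cases i rule: all_3E) (simp_all add: der_apply_alpha der_power_def)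
qed

lemma der_det_frobenius:
  fixes \<theta> \<phi> :: "'a::field Der"
  assumes "prime p" "CHAR('a) = p"
  shows "der_det (der_power p \<theta>) (der_power p \<phi>) = der_det \<theta> \<phi> ^ p"
proof -
  have "(fst \<theta> * snd \<phi>) ^ p = (der_det \<theta> \<phi> + fst \<phi> * snd \<theta>) ^ p"
    by (simp add: der_det_def)
  also have "\<dots> = der_det \<theta> \<phi> ^ p + (fst \<phi> * snd \<theta>) ^ p"
    using assms by (intro freshmans_dream) simp_all
  finally show ?thesis by (simp add: der_det_def der_power_def power_mult_distrib)
qed

lemma smult_nth [simp]: "((n :: nat) *s \<mu>) $ i = n * \<mu> $ i"
  by (simp add: vector_scalar_mult_def)

lemma size_mult_smult: "size_mult (n *s \<mu>) = n * size_mult \<mu>"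
  by (simp add: size_mult_def sum_distrib_left)

lemma Q_smult: "Q (n *s \<mu>) = Q \<mu> ^ n"
  by (simp only: Q_def smult_nth mult.commute[of n] power_mult prod_power_distrib)

lemma cst_power: "cst c ^ n = cst (c ^ n)"
  by (induction n) (simp_all add: cst_mult)

text \<open>In characteristic \<open>p\<close> taking \<open>p\<close>-th powers is additive, hence
  commutes with applying a derivation to \<open>alpha i\<close> and with the determinant; the whole
  criterion is raised to the \<open>p\<close>-th power.\<close>

lemma saito_basis_frobenius:
  fixes \<theta> \<phi> :: "'a::field Der"
  assumes p: "prime p" "CHAR('a) = p" and b: "saito_basis \<mu> d e \<theta> \<phi>"
  shows "saito_basis (p *s \<mu>) (p * d) (p * e) (der_power p \<theta>) (der_power p \<phi>)"
proof -
  obtain c where c: "c \<noteq> 0" "der_det \<theta> \<phi> = cst c * Q \<mu>"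
    using b unfolding saito_basis_def by blast
  have D: "\<theta> \<in> D \<mu>" "\<phi> \<in> D \<mu>" and h: "der_homogeneous d \<theta>" "der_homogeneous e \<phi>"
    using b unfolding saito_basis_def by blast+
  have "der_power p \<psi> \<in> D (p *s \<mu>)" if "\<psi> \<in> D \<mu>" for \<psi> :: "'a Der"
    unfolding in_D_iff der_apply_frobenius[OF p] smult_nth mult.commute[of p] power_mult
    using that by (simp add: in_D_iff dvd_power_same)
  moreover have "der_homogeneous (p * n) (der_power p \<psi>)" if "der_homogeneous n \<psi>" for n and \<psi> :: "'a Der"
    using that by (simp add: der_homogeneous_def der_power_def homogeneous_power)
  moreover have "der_det (der_power p \<theta>) (der_power p \<phi>) = cst (c ^ p) * Q (p *s \<mu>)"
    by (simp add: der_det_frobenius[OF p] c(2) power_mult_distrib cst_power Q_smult)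
  moreover have "c ^ p \<noteq> 0" using c(1) by simp
  ultimately show ?thesis using D h unfolding saito_basis_def by blast
qed

lemma Delta_frobenius:
  assumes "prime p" "CHAR('a::field) = p"
  shows "Delta TYPE('a) (p *s \<mu>) = p * Delta TYPE('a) \<mu>"
proof -
  obtain d e and \<theta> \<phi> :: "'a Der" where b: "saito_basis \<mu> d e \<theta> \<phi>" "d \<le> e"
    by (rule saito_basis_exists)
  have "mdeg TYPE('a) (p *s \<mu>) = p * d"
    using saito_basis_mdeg[OF saito_basis_frobenius[OF assms b(1)]] b(2) by simp
  then show ?thesis
    by (simp add: Delta_eq size_mult_smult saito_basis_mdeg[OF b] diff_mult_distrib2 mult_ac)
qed

section \<open>Partial derivatives and divisibility by powers of a linear form\<close>

text \<open>Collects what \<open>partial_x\<close> and \<open>partial_y\<close> share, so that the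
  divisibility argument is made once. The truncated \<open>d - 1\<close> is harmless at
  \<open>d = 0\<close>: constants go to zero, which is homogeneous of every degree.\<close>

definition derivation :: "('a::field S \<Rightarrow> 'a S) \<Rightarrow> bool" where
  "derivation \<delta> \<longleftrightarrow> (\<forall>f g. \<delta> (f + g) = \<delta> f + \<delta> g) \<and> (\<forall>f g. \<delta> (f * g) = f * \<delta> g + g * \<delta> f) \<and>
     (\<forall>c. \<delta> (cst c) = 0) \<and> (\<forall>d f. homogeneous d f \<longrightarrow> homogeneous (d - 1) (\<delta> f))"

lemma derivation_power:
  assumes "derivation \<delta>"
  shows "\<delta> (a ^ Suc n) = of_nat (Suc n) * a ^ n * \<delta> a"
proof (induction n)
  case (Suc n)
  have "\<delta> (a ^ Suc (Suc n)) = a * \<delta> (a ^ Suc n) + a ^ Suc n * \<delta> a"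
    using assms by (simp add: derivation_def)
  then show ?case unfolding Suc by (simp add: algebra_simps)
qed simp

lemma derivation_dvd:
  assumes "derivation \<delta>" "a ^ Suc n dvd f"
  shows "a ^ n dvd \<delta> f"
proof -
  obtain u where u: "f = a ^ Suc n * u" using assms(2) by blast
  have "\<delta> f = a ^ Suc n * \<delta> u + u * \<delta> (a ^ Suc n)"
    using assms(1) unfolding u derivation_def by blast
  also have "\<dots> = a ^ n * (a * \<delta> u + u * of_nat (Suc n) * \<delta> a)"
    unfolding derivation_power[OF assms(1)] by (simp add: algebra_simps)
  finally show ?thesis by simp
qed

lemma derivation_dvd_const:
  assumes "derivation \<delta>" "\<delta> a = 0" "a ^ n dvd f"
  shows "a ^ n dvd \<delta> f"
proof -
  obtain u where u: "f = a ^ n * u" using assms(3) by blast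
  have "\<delta> 1 = 0" using assms(1) unfolding derivation_def by (metis cst_1)
  then have "\<delta> (a ^ n) = 0"
    using derivation_power[OF assms(1), of a] assms(2) by (cases n) simp_all
  moreover have "\<delta> f = a ^ n * \<delta> u + u * \<delta> (a ^ n)"
    using assms(1) unfolding u derivation_def by blast
  ultimately show ?thesis by simp
qed

text \<open>Dividing the product rule by \<open>a ^ (n - 1)\<close> shows that \<open>a\<close>
  divides \<open>of_nat n * u\<close>; if \<open>of_nat n\<close> were invertible, \<open>a\<close>
  would divide \<open>u\<close>.\<close>

lemma derivation_vanish_exponent:
  fixes a :: "'a::field S"
  assumes "derivation \<delta>" "\<delta> a = 1" "a \<noteq> 0" "\<delta> (a ^ n * u) = 0" "\<not> a dvd u"
  shows "of_nat n = (0 :: 'a)"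
proof (rule ccontr)
  assume nz: "of_nat n \<noteq> (0 :: 'a)"
  then obtain m where m: "n = Suc m" by (cases n) auto
  have n: "of_nat n = cst (of_nat n :: 'a)" by (simp add: of_nat_poly cst_def)
  have "0 = a ^ n * \<delta> u + u * \<delta> (a ^ n)"
    using assms(1,4) unfolding derivation_def by metis
  also have "\<dots> = a ^ m * (a * \<delta> u + of_nat n * u)"
    unfolding m derivation_power[OF assms(1)] assms(2) by (simp add: algebra_simps)
  finally have "cst (of_nat n) * u = a * (- \<delta> u)"
    using assms(3) by (simp add: n add_eq_0_iff)
  then have "u = a * (cst (inverse (of_nat n)) * (- \<delta> u))"
    using const_poly_inverse[OF nz, of u] by (simp only: mult.left_commute)
  then have "a dvd u" by (rule dvdI)
  with assms(5) show False ..
qed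

lemma derivation_partial_x: "derivation (partial_x :: 'a::field S \<Rightarrow> 'a S)"
  unfolding derivation_def
proof (intro conjI allI impI)
  have c: "coeff (partial_x f) n = pderiv (coeff f n)" for f :: "'a S" and n
    by (simp add: partial_x_def coeff_map_poly)
  fix f g :: "'a S"
  show "partial_x (f + g) = partial_x f + partial_x g"
    by (intro poly_eqI) (simp only: c coeff_add pderiv_add)
  have s: "pderiv (sum h A) = (\<Sum>i\<in>A. pderiv (h i))" for h :: "nat \<Rightarrow> 'a poly" and A
    by (induction A rule: infinite_finite_induct) (simp_all add: pderiv_add)
  have "partial_x (f * g) = f * partial_x g + partial_x f * g"
  proof (rule poly_eqI)
    fix n
    have "pderiv (coeff f i * coeff g (n - i)) =
        coeff f i * pderiv (coeff g (n - i)) + pderiv (coeff f i) * coeff g (n - i)" for i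
      by (simp only: pderiv_mult mult.commute)
    then show "coeff (partial_x (f * g)) n = coeff (f * partial_x g + partial_x f * g) n"
      by (simp only: c coeff_add coeff_mult s sum.distrib)
  qed
  then show "partial_x (f * g) = f * partial_x g + g * partial_x f"
    by (simp only: mult.commute)
  fix d assume h: "homogeneous d f"
  have "i + j = d - 1" if "coeff (coeff (partial_x f) j) i \<noteq> 0" for i j
  proof -
    have "coeff (coeff f j) (Suc i) \<noteq> 0" using that by (auto simp: c coeff_pderiv)
    then have "Suc i + j = d" using h unfolding homogeneous_def by blast
    then show ?thesis by simp
  qed
  then show "homogeneous (d - 1) (partial_x f)" unfolding homogeneous_def by blast
qed (simp add: partial_x_def cst_def map_poly_pCons)

lemma derivation_partial_y: "derivation (partial_y :: 'a::field S \<Rightarrow> 'a S)"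
  unfolding derivation_def partial_y_def
proof (intro conjI allI impI)
  fix d and f :: "'a S" assume h: "homogeneous d f"
  have "i + j = d - 1" if "coeff (coeff (pderiv f) j) i \<noteq> 0" for i j
  proof -
    have "coeff (coeff f (Suc j)) i \<noteq> 0"
    proof
      assume "coeff (coeff f (Suc j)) i = 0"
      then have "coeff (of_nat (Suc j) * coeff f (Suc j)) i = 0"
        by (simp add: of_nat_poly del: of_nat_Suc)
      then show False using that by (simp add: coeff_pderiv)
    qed
    then have "i + Suc j = d" using h unfolding homogeneous_def by blast
    then show ?thesis by simp
  qed
  then show "homogeneous (d - 1) (pderiv f)" unfolding homogeneous_def by blast
qed (simp_all add: pderiv_add pderiv_mult cst_def pderiv_pCons)

lemma partial_alpha:
  "partial_x (alpha 1) = 1" "partial_x (alpha 2) = 0" "partial_x (alpha 3) = 1"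
  "partial_y (alpha 1) = 0" "partial_y (alpha 2) = 1" "partial_y (alpha 3) = 1"
  by (simp_all add: partial_x_def partial_y_def alpha_1 alpha_2 alpha_3
      map_poly_pCons pderiv_pCons map_poly_1 flip: one_pCons)

text \<open>Since \<open>\<delta>\<close> lowers degrees and loses only one power of \<open>alpha i\<close> and of \<open>alpha j\<close>,
  it kills a derivation whose degree is minimal even for \<open>\<nu>\<close>.\<close>

lemma CHAR_dvd_multiplicity:
  fixes \<delta> :: "'a::field S \<Rightarrow> 'a S" and \<zeta> \<nu> :: multiplicity
  assumes \<delta>: "derivation \<delta>" "\<delta> (alpha i) = 1" "\<And>k. k \<noteq> i \<Longrightarrow> k \<noteq> j \<Longrightarrow> \<delta> (alpha k) = 0"
    and ij: "i \<noteq> j" and \<zeta>: "\<zeta> = incr i (incr j \<nu>)"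
    and m: "mdeg TYPE('a) \<nu> = mdeg TYPE('a) \<zeta>" "mdeg TYPE('a) \<zeta> < mdeg TYPE('a) (incr i \<zeta>)"
  shows "CHAR('a) dvd \<zeta> $ i"
proof -
  define d where "d = mdeg TYPE('a) \<zeta>"
  obtain \<theta> :: "'a Der" where \<theta>: "\<theta> \<in> D \<zeta>" "\<theta> \<noteq> 0" "der_homogeneous d \<theta>"
    unfolding d_def by (rule mdeg_obtain)
  define \<psi> where "\<psi> = (\<delta> (fst \<theta>), \<delta> (snd \<theta>))"
  have app: "der_apply \<psi> (alpha k) = \<delta> (der_apply \<theta> (alpha k))" for k
    using \<delta>(1) by (cases k rule: all_3E) (simp_all add: der_apply_alpha \<psi>_def derivation_def)
  have "\<psi> = 0"
  \<comment> \<open>At \<open>d = 0\<close> the truncated \<open>d - 1\<close> is not smaller than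
    \<open>d\<close>, so degrees give no contradiction; there the coefficients are constants and are
    killed directly.\<close>
  proof (cases "d = 0")
    case True
    then obtain a b where "fst \<theta> = cst a" "snd \<theta> = cst b"
      using \<theta>(3) homogeneous_0_obtain unfolding der_homogeneous_def by metis
    then show ?thesis using \<delta>(1) by (simp add: \<psi>_def derivation_def prod_eq_iff)
  next
    case False
    have "alpha k ^ (\<nu> $ k) dvd der_apply \<psi> (alpha k)" for k
    proof (cases "k = i \<or> k = j")
      case True
      then have "\<zeta> $ k = Suc (\<nu> $ k)" using ij by (auto simp: \<zeta>)
      then show ?thesis
        using derivation_dvd[OF \<delta>(1)] \<theta>(1) unfolding app in_D_iff by metis
    next
      case False
      then have "\<zeta> $ k = \<nu> $ k" by (auto simp: \<zeta>)
      then show ?thesis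
        using derivation_dvd_const[OF \<delta>(1)] \<delta>(3) False \<theta>(1) unfolding app in_D_iff by metis
    qed
    then have "\<psi> \<in> D \<nu>" by (simp add: in_D_iff)
    moreover have "der_homogeneous (d - 1) \<psi>"
      using \<delta>(1) \<theta>(3) by (simp add: der_homogeneous_def \<psi>_def derivation_def)
    moreover have "d - 1 < mdeg TYPE('a) \<nu>" using False m(1) d_def by simp
    ultimately show ?thesis using mdeg_le by (metis not_less)
  qed
  obtain u where u: "der_apply \<theta> (alpha i) = alpha i ^ (\<zeta> $ i) * u"
    using \<theta>(1) unfolding in_D_iff by blast
  \<comment> \<open>One more factor \<open>alpha i\<close> would put \<open>\<theta>\<close> into
    \<open>D (incr i \<zeta>)\<close> without raising its degree, against
    \<open>m(2)\<close>.\<close>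
  have "\<not> alpha i dvd u"
  proof
    assume "alpha i dvd u"
    then have "\<theta> \<in> D (incr i \<zeta>)"
      using \<theta>(1) u unfolding D_incr_iff by (simp add: mult.commute mult_dvd_mono)
    then show False using mdeg_le[OF _ \<theta>(2,3)] m(2) d_def by fastforce
  qed
  moreover have "\<delta> (alpha i ^ (\<zeta> $ i) * u) = 0"
    using app[of i] \<open>\<psi> = 0\<close> unfolding u by (simp add: der_apply_def)
  ultimately have "of_nat (\<zeta> $ i) = (0 :: 'a)"
    by (intro derivation_vanish_exponent[OF \<delta>(1,2)]) simp_all
  then show ?thesis by (simp add: of_nat_eq_0_iff_char_dvd)
qed

section \<open>Peaks and components\<close>

lemma l1_dist_3: "l1_dist \<mu> \<zeta> = nat \<bar>int (\<mu> $ 1) - int (\<zeta> $ 1)\<bar> +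
    nat \<bar>int (\<mu> $ 2) - int (\<zeta> $ 2)\<bar> + nat \<bar>int (\<mu> $ 3) - int (\<zeta> $ 3)\<bar>"
  by (simp add: l1_dist_def sum_3)

lemma l1_dist_eq_0_iff [simp]: "l1_dist \<mu> \<zeta> = 0 \<longleftrightarrow> \<mu> = \<zeta>"
  by (auto simp: l1_dist_def vec_eq_iff)

lemma l1_dist_self [simp]: "l1_dist \<mu> \<mu> = 0"
  by simp

lemma l1_dist_incr_away:
  assumes "\<zeta> $ i \<le> \<mu> $ i"
  shows "l1_dist (incr i \<mu>) \<zeta> = Suc (l1_dist \<mu> \<zeta>)"
  using assms by (cases i rule: all_3E) (simp_all add: l1_dist_3)

lemma l1_dist_incr_towards:
  assumes "\<mu> $ i < \<zeta> $ i"
  shows "l1_dist \<mu> \<zeta> = Suc (l1_dist (incr i \<mu>) \<zeta>)"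
  using assms by (cases i rule: all_3E) (simp_all add: l1_dist_3)

lemma l1_dist_single:
  assumes "\<And>j. j \<noteq> i \<Longrightarrow> \<mu> $ j = \<zeta> $ j"
  shows "l1_dist \<mu> \<zeta> = nat \<bar>int (\<mu> $ i) - int (\<zeta> $ i)\<bar>"
  using assms by (cases i rule: all_3E) (simp_all add: l1_dist_3)

lemma l1_dist_smult: "l1_dist (n *s \<mu>) (n *s \<zeta>) = n * l1_dist \<mu> \<zeta>"
proof -
  have "nat \<bar>int (n * a) - int (n * b)\<bar> = n * nat \<bar>int a - int b\<bar>" for a b
    by (simp add: nat_mult_distrib abs_mult flip: right_diff_distrib)
  then show ?thesis by (simp only: l1_dist_def smult_nth sum_distrib_left)
qed

lemma incr_obtain:
  assumes "0 < \<mu> $ i"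
  obtains \<nu> where "\<mu> = incr i \<nu>"
proof
  show "\<mu> = incr i (\<mu> - axis i 1)"
    using assms by (auto simp: incr_def vec_eq_iff axis_def)
qed

lemma incr_commute: "incr i (incr j \<mu>) = incr j (incr i \<mu>)"
  by (simp add: incr_def add_ac)

lemma adjacent_iff: "adjacent \<mu> \<nu> \<longleftrightarrow> (\<exists>i. \<mu> = incr i \<nu> \<or> \<nu> = incr i \<mu>)"
  by (simp add: adjacent_def incr_def)

lemma adjacent_incr [simp]: "adjacent (incr i \<mu>) \<mu>" "adjacent \<mu> (incr i \<mu>)"
  by (auto simp: adjacent_iff)

lemma l1_dist_adjacent:
  assumes "adjacent \<mu> \<nu>"
  shows "l1_dist \<mu> \<zeta> = Suc (l1_dist \<nu> \<zeta>) \<or> l1_dist \<nu> \<zeta> = Suc (l1_dist \<mu> \<zeta>)"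
proof -
  have "l1_dist (incr i \<rho>) \<zeta> = Suc (l1_dist \<rho> \<zeta>) \<or> l1_dist \<rho> \<zeta> = Suc (l1_dist (incr i \<rho>) \<zeta>)" for i \<rho>
    using l1_dist_incr_away[of \<zeta> i \<rho>] l1_dist_incr_towards[of \<rho> i \<zeta>] by linarith
  then show ?thesis using assms unfolding adjacent_iff by blast
qed

lemma l1_dist_inner_neighbour:
  assumes "l1_dist \<mu> \<zeta> = Suc n"
  obtains \<nu> where "adjacent \<mu> \<nu>" "l1_dist \<nu> \<zeta> = n"
proof -
  have "\<mu> \<noteq> \<zeta>" using assms l1_dist_eq_0_iff by (metis nat.distinct(1))
  then obtain i where "\<mu> $ i \<noteq> \<zeta> $ i" by (auto simp: vec_eq_iff)
  then consider "\<zeta> $ i < \<mu> $ i" | "\<mu> $ i < \<zeta> $ i" by linarith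
  then show thesis
  proof cases
    case 1
    then obtain \<nu> where \<nu>: "\<mu> = incr i \<nu>" using incr_obtain by (metis gr_zeroI not_less_zero)
    then show ?thesis using that[of \<nu>] 1 assms l1_dist_incr_away[of \<zeta> i \<nu>] by simp
  next
    case 2
    then show ?thesis using that[of "incr i \<mu>"] assms l1_dist_incr_towards[OF 2] by simp
  qed
qed

text \<open>Neighbouring values of \<open>Delta\<close> differ by exactly one, so this describes a
  local maximum. The successor avoids truncated subtraction and forces \<open>r\<close> to be
  positive.\<close>

definition peak :: "'a::field itself \<Rightarrow> nat \<Rightarrow> multiplicity \<Rightarrow> bool" where
  "peak F r \<zeta> \<longleftrightarrow> Delta F \<zeta> = r \<and> (\<forall>\<mu>. adjacent \<mu> \<zeta> \<longrightarrow> Suc (Delta F \<mu>) = r)"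

text \<open>The cone around a peak is built from the outside of a square (or of a line segment) whose
  three inner points are already known; the valley lemmas decide the value at the outer point.\<close>

lemma Delta_peak:
  assumes pk: "peak TYPE('a::field) r \<zeta>" and "l1_dist \<mu> \<zeta> \<le> r"
  shows "Delta TYPE('a) \<mu> + l1_dist \<mu> \<zeta> = r"
  using assms(2)
proof (induction "l1_dist \<mu> \<zeta>" arbitrary: \<mu> rule: less_induct)
  case less
  let ?\<Delta> = "Delta TYPE('a)" and ?d = "\<lambda>\<mu>. l1_dist \<mu> \<zeta>"
  have IH: "?\<Delta> \<nu> + ?d \<nu> = r" if "?d \<nu> < ?d \<mu>" for \<nu>
    using less that by simp
  consider "?d \<mu> = 0" | "?d \<mu> = 1" | k where "?d \<mu> = Suc (Suc k)"
    by (metis One_nat_def not0_implies_Suc)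
  then show ?case
  proof cases
    case 1
    then show ?thesis using pk by (simp add: peak_def)
  next
    case 2
    then obtain \<nu> where "adjacent \<mu> \<nu>" "?d \<nu> = 0"
      using l1_dist_inner_neighbour by (metis One_nat_def)
    then show ?thesis using pk 2 by (auto simp: peak_def)
  next
    case (3 k)
    \<comment> \<open>The value at points one step closer to the peak than \<open>\<mu>\<close>; it
      is positive because the distance of \<open>\<mu>\<close> is at most \<open>r\<close>, as the
      valley lemmas require.\<close>
    define v where "v = r - Suc k"
    have v: "0 < v" "Suc k + v = r" using 3 less.prems by (auto simp: v_def)
    have inner: "?\<Delta> \<nu> = v" if "?d \<nu> = Suc k" for \<nu>
      using IH[of \<nu>] that 3 v(2) by simp
    have inner2: "?\<Delta> \<nu> = Suc v" if "?d \<nu> = k" for \<nu>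
      using IH[of \<nu>] that 3 v(2) by simp
    \<comment> \<open>A neighbour with value \<open>v\<close> leaves only \<open>v - 1\<close> and
      \<open>v + 1\<close> for \<open>\<mu>\<close>, and a valley argument excludes the
      latter.\<close>
    have "?\<Delta> \<mu> \<noteq> Suc v \<and> (\<exists>\<nu>. adjacent \<mu> \<nu> \<and> ?\<Delta> \<nu> = v)"
    proof (cases "\<exists>i j. i \<noteq> j \<and> \<mu> $ i \<noteq> \<zeta> $ i \<and> \<mu> $ j \<noteq> \<zeta> $ j")
      case True
      then obtain i j where "i \<noteq> j" "\<mu> $ i \<noteq> \<zeta> $ i" "\<mu> $ j \<noteq> \<zeta> $ j" by blast
      then consider (up) "i \<noteq> j" "\<zeta> $ i < \<mu> $ i" "\<zeta> $ j < \<mu> $ j"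
        | (down) "i \<noteq> j" "\<mu> $ i < \<zeta> $ i" "\<mu> $ j < \<zeta> $ j"
        | (mixed) i j where "i \<noteq> j" "\<zeta> $ i < \<mu> $ i" "\<mu> $ j < \<zeta> $ j"
        by (metis not_less_iff_gr_or_eq)
      then show ?thesis
      proof cases
        case up
        obtain \<nu> where \<nu>: "\<mu> = incr i \<nu>" using up(2) incr_obtain by (metis gr_zeroI not_less_zero)
        then have "0 < \<nu> $ j" using up by auto
        then obtain \<rho> where \<rho>: "\<nu> = incr j \<rho>" by (rule incr_obtain)
        have d: "?d \<mu> = Suc (?d (incr j \<rho>))" "?d (incr j \<rho>) = Suc (?d \<rho>)" "?d (incr i \<rho>) = Suc (?d \<rho>)"
          using up unfolding \<nu> \<rho> by (auto intro!: l1_dist_incr_away split: if_splits)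
        have "?\<Delta> (incr i \<rho>) = v" "?\<Delta> (incr j \<rho>) = v" "?\<Delta> \<rho> = Suc v"
          using d 3 by (auto intro: inner inner2)
        then show ?thesis
          using Delta_valley_square[OF up(1) v(1)] unfolding \<nu> \<rho> by (metis adjacent_incr(1))
      next
        case down
        have d: "?d \<mu> = Suc (?d (incr j \<mu>))" "?d (incr j \<mu>) = Suc (?d (incr i (incr j \<mu>)))"
            "?d \<mu> = Suc (?d (incr i \<mu>))"
          using down by (auto intro!: l1_dist_incr_towards)
        have "?\<Delta> (incr i \<mu>) = v" "?\<Delta> (incr j \<mu>) = v" "?\<Delta> (incr i (incr j \<mu>)) = Suc v"
          using d 3 by (auto intro: inner inner2)
        then show ?thesis
          using Delta_valley_square[OF down(1) v(1)] by (metis adjacent_incr(2))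
      next
        case mixed
        \<comment> \<open>Here \<open>\<mu>\<close> and the corner nearest to the peak are the two
          middle corners of the square, while its lowest and highest corners both have value
          \<open>v\<close>.\<close>
        obtain \<nu> where \<nu>: "\<mu> = incr i \<nu>" using mixed(2) incr_obtain by (metis gr_zeroI not_less_zero)
        have "?d (incr i \<nu>) = Suc (?d \<nu>)" "?d \<nu> = Suc (?d (incr j \<nu>))"
            "?d (incr i (incr j \<nu>)) = Suc (?d (incr j \<nu>))"
          using mixed unfolding \<nu> by (auto intro!: l1_dist_incr_towards l1_dist_incr_away)
        then have "?\<Delta> \<nu> = v" "?\<Delta> (incr j \<nu>) = Suc v" "?\<Delta> (incr j (incr i \<nu>)) = v"
          using 3 unfolding \<nu> by (auto intro!: inner inner2 simp: incr_commute[of j])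
        then show ?thesis
          using Delta_valley_diagonal[OF mixed(1)[symmetric] v(1)] unfolding \<nu>
          by (metis adjacent_incr(1))
      qed
    next
      case False
      have "\<mu> \<noteq> \<zeta>" using 3 l1_dist_eq_0_iff by (metis nat.distinct(1))
      then obtain i where i: "\<mu> $ i \<noteq> \<zeta> $ i" by (auto simp: vec_eq_iff)
      \<comment> \<open>Only coordinate \<open>i\<close> differs, so the whole distance lies in it
        and a straight segment of two steps towards the peak is available.\<close>
      then have "?d \<mu> = nat \<bar>int (\<mu> $ i) - int (\<zeta> $ i)\<bar>"
        using False by (intro l1_dist_single) blast
      then consider (up) "Suc (\<zeta> $ i) < \<mu> $ i" | (down) "Suc (\<mu> $ i) < \<zeta> $ i"
        using 3 by linarith
      then show ?thesis
      proof cases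
        case up
        obtain \<nu> where \<nu>: "\<mu> = incr i \<nu>" using up incr_obtain by (metis gr_zeroI not_less_zero)
        then have "0 < \<nu> $ i" using up by auto
        then obtain \<rho> where \<rho>: "\<nu> = incr i \<rho>" by (rule incr_obtain)
        have "?d (incr i (incr i \<rho>)) = Suc (?d (incr i \<rho>))" "?d (incr i \<rho>) = Suc (?d \<rho>)"
          using up unfolding \<nu> \<rho> by (auto intro!: l1_dist_incr_away)
        then have "?\<Delta> (incr i \<rho>) = v" "?\<Delta> \<rho> = Suc v"
          using 3 unfolding \<nu> \<rho> by (auto intro: inner inner2)
        then show ?thesis
          using Delta_valley_line[OF v(1)] unfolding \<nu> \<rho> by (metis adjacent_incr(1))
      next
        case down
        have "?d \<mu> = Suc (?d (incr i \<mu>))" "?d (incr i \<mu>) = Suc (?d (incr i (incr i \<mu>)))"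
          using down by (auto intro!: l1_dist_incr_towards)
        then have "?\<Delta> (incr i \<mu>) = v" "?\<Delta> (incr i (incr i \<mu>)) = Suc v"
          using 3 by (auto intro: inner inner2)
        then show ?thesis
          using Delta_valley_line[OF v(1)] by (metis adjacent_incr(2))
      qed
    qed
    then obtain \<nu> where \<nu>: "?\<Delta> \<mu> \<noteq> Suc v" "adjacent \<mu> \<nu>" "?\<Delta> \<nu> = v" by blast
    then have "Suc (?\<Delta> \<mu>) = v"
      using Delta_incr[where 'a = 'a] unfolding adjacent_iff by metis
    then show ?thesis using 3 v(2) by simp
  qed
qed

section \<open>Bounds for balanced multiplicities\<close>

lemma mem_Lambda_bal_iff: "\<mu> \<in> Lambda_bal \<longleftrightarrow> (\<forall>i. 2 * \<mu> $ i \<le> size_mult \<mu>)"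
proof -
  have "real a \<le> real b / 2 \<longleftrightarrow> 2 * a \<le> b" for a b :: nat by linarith
  then show ?thesis by (simp add: Lambda_bal_def balanced_def)
qed

text \<open>A nonzero derivation in \<open>D \<mu>\<close> of degree below \<open>\<mu> $ i\<close>
  must kill \<open>alpha i\<close>. Its remaining coefficient is then divisible by the other two
  powers, so its degree is at least the sum of the other two coordinates, which balance makes at
  least \<open>\<mu> $ i\<close>.\<close>

lemma Lambda_bal_le_mdeg:
  assumes "\<mu> \<in> Lambda_bal"
  shows "\<mu> $ i \<le> mdeg TYPE('a::field) \<mu>"
proof (rule ccontr)
  define m where "m = mdeg TYPE('a) \<mu>"
  assume "\<not> ?thesis"
  then have lt: "m < \<mu> $ i" by (simp add: m_def)
  obtain \<psi> :: "'a Der" where \<psi>: "\<psi> \<in> D \<mu>" "\<psi> \<noteq> 0" "der_homogeneous m \<psi>"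
    unfolding m_def by (rule mdeg_obtain)
  obtain u where u: "der_apply \<psi> (alpha i) = alpha i ^ (\<mu> $ i) * u"
    using \<psi>(1) unfolding in_D_iff by blast
  have "u = 0"
    using homogeneous_alpha_power_multD[of m i "\<mu> $ i" u] homogeneous_der_apply_alpha[OF \<psi>(3), of i] lt
    by (auto simp: u)
  then have app: "der_apply \<psi> (alpha i) = 0" using u by simp
  \<comment> \<open>A coefficient that survives: \<open>alpha 1\<close> and \<open>alpha 2\<close>
    being killed means that the first or second one vanishes, while for \<open>alpha 3\<close> they
    agree up to sign.\<close>
  define g where "g = (if i = 2 then fst \<psi> else snd \<psi>)"
  define \<nu> :: multiplicity where "\<nu> = (\<chi> j. if j = i then 0 else \<mu> $ j)"
  have D3: "alpha 1 ^ (\<mu> $ 1) dvd fst \<psi>" "alpha 2 ^ (\<mu> $ 2) dvd snd \<psi>"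
    "alpha 3 ^ (\<mu> $ 3) dvd fst \<psi> + snd \<psi>"
    using \<psi>(1) unfolding in_D_iff by (metis der_apply_alpha)+
  have g: "g \<noteq> 0" "alpha j ^ (\<nu> $ j) dvd g" for j
  proof -
    show "g \<noteq> 0"
      using app \<psi>(2) by (cases i rule: all_3E) (auto simp: der_apply_alpha g_def prod_eq_iff)
    have "fst \<psi> = - snd \<psi>" if "i = 3"
      using app that by (simp add: der_apply_alpha add_eq_0_iff)
    then show "alpha j ^ (\<nu> $ j) dvd g"
      using app D3 by (cases i rule: all_3E; cases j rule: all_3E)
        (simp_all add: der_apply_alpha g_def \<nu>_def)
  qed
  have "Q \<nu> dvd g" by (intro Q_dvdI g)
  then obtain w where w: "g = Q \<nu> * w" by blast
  then have "w \<noteq> 0" using g(1) by auto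
  moreover have "homogeneous m g" using \<psi>(3) by (simp add: g_def der_homogeneous_def)
  ultimately have "size_mult \<nu> \<le> m" using homogeneous_Q_multD unfolding w by blast
  moreover have "size_mult \<nu> + \<mu> $ i = size_mult \<mu>"
    by (cases i rule: all_3E) (simp_all add: size_mult_3 \<nu>_def)
  moreover have "2 * \<mu> $ i \<le> size_mult \<mu>" using assms by (simp add: mem_Lambda_bal_iff)
  ultimately show False using lt by linarith
qed

text \<open>Summing the three coordinate bounds gives \<open>size_mult \<mu> \<le> 3 * mdeg\<close>;
  the rest is \<open>size_mult_Delta\<close>. The factor 3 is what later bounds any ascent of slope
  one.\<close>

lemma Lambda_bal_Delta_le:
  assumes "\<mu> \<in> Lambda_bal"
  shows "3 * Delta TYPE('a::field) \<mu> \<le> size_mult \<mu>"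
proof -
  note le = Lambda_bal_le_mdeg[OF assms, where 'a = 'a]
  show ?thesis
    using le[of 1] le[of 2] le[of 3] size_mult_Delta[where 'a = 'a, of \<mu>]
    unfolding size_mult_3 by linarith
qed

text \<open>If one coordinate were 0, the other two would sum to at most twice the least degree,
  leaving \<open>Delta\<close> zero. Positivity permits stepping down from a peak.\<close>

lemma Lambda_bal_coordinate_pos:
  assumes "\<mu> \<in> Lambda_bal" "0 < Delta TYPE('a::field) \<mu>"
  shows "0 < \<mu> $ i"
proof -
  note le = Lambda_bal_le_mdeg[OF assms(1), where 'a = 'a]
  have pos: "0 < \<mu> $ 1" "0 < \<mu> $ 2" "0 < \<mu> $ 3"
    using le[of 1] le[of 2] le[of 3] size_mult_Delta[where 'a = 'a, of \<mu>] assms(2)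
    unfolding size_mult_3 by linarith+
  show ?thesis
    using pos by (cases i rule: all_3E) simp_all
qed

section \<open>Radius and center of a balanced peak\<close>

text \<open>Lowering two coordinates by one loses 2 in both size and \<open>Delta\<close>, so the
  least degree is unchanged and \<open>CHAR_dvd_multiplicity\<close> applies.
  \<open>partial_x\<close> annihilates \<open>alpha 2\<close> and handles coordinates 1 and 3;
  \<open>partial_y\<close> annihilates \<open>alpha 1\<close> and handles coordinate 2 paired with
  3.\<close>

lemma peak_dvd_coordinate:
  assumes pk: "peak TYPE('a::field) r \<zeta>" and r: "2 \<le> r" and bal: "\<zeta> \<in> Lambda_bal"
  shows "CHAR('a) dvd \<zeta> $ i"
proof -
  have dvd: "CHAR('a) dvd \<zeta> $ i"
    if \<delta>: "derivation (\<delta> :: 'a S \<Rightarrow> 'a S)" "\<delta> (alpha i) = 1"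
      "\<And>k. k \<noteq> i \<Longrightarrow> k \<noteq> j \<Longrightarrow> \<delta> (alpha k) = 0" and ij: "i \<noteq> j" for \<delta> i j
  proof -
    have pos: "0 < \<zeta> $ l" for l
      using Lambda_bal_coordinate_pos[OF bal, where 'a = 'a] pk r by (simp add: peak_def)
    obtain \<nu>' where \<nu>': "\<zeta> = incr i \<nu>'" using incr_obtain[OF pos] .
    have "0 < \<nu>' $ j" using pos[of j] ij by (simp add: \<nu>')
    then obtain \<nu> where "\<nu>' = incr j \<nu>" by (rule incr_obtain)
    then have \<nu>: "\<zeta> = incr i (incr j \<nu>)" using \<nu>' by simp
    have "l1_dist \<nu> \<zeta> = Suc (l1_dist (incr j \<nu>) \<zeta>)"
      using ij by (intro l1_dist_incr_towards) (simp add: \<nu>)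
    also have "l1_dist (incr j \<nu>) \<zeta> = Suc (l1_dist \<zeta> \<zeta>)"
      using ij l1_dist_incr_towards[of "incr j \<nu>" i \<zeta>] by (simp add: \<nu>)
    finally have "l1_dist \<nu> \<zeta> = 2" by simp
    then have "Delta TYPE('a) \<nu> + 2 = r" using Delta_peak[OF pk, of \<nu>] r by simp
    moreover have "Delta TYPE('a) \<zeta> = r" using pk by (simp add: peak_def)
    moreover have "size_mult \<zeta> = size_mult \<nu> + 2" by (simp add: \<nu>)
    ultimately have m: "mdeg TYPE('a) \<nu> = mdeg TYPE('a) \<zeta>"
      using size_mult_Delta[where 'a = 'a, of \<nu>] size_mult_Delta[where 'a = 'a, of \<zeta>] by linarith
    have "Suc (Delta TYPE('a) (incr i \<zeta>)) = r" using pk by (simp add: peak_def)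
    then have "mdeg TYPE('a) \<zeta> < mdeg TYPE('a) (incr i \<zeta>)"
      using mdeg_incr_Delta_down[of \<zeta> i, where 'a = 'a] pk by (simp add: peak_def)
    then show ?thesis using CHAR_dvd_multiplicity[OF \<delta> ij \<nu> m] by blast
  qed
  have "partial_x (alpha k) = (0 :: 'a S)" if "k \<noteq> 1" "k \<noteq> 3" for k
    using that by (cases k rule: all_3E) (simp_all add: partial_alpha)
  then have "CHAR('a) dvd \<zeta> $ 1" "CHAR('a) dvd \<zeta> $ 3"
    using dvd[OF derivation_partial_x, of 1 3] dvd[OF derivation_partial_x, of 3 1]
    by (simp_all add: partial_alpha)
  moreover have "partial_y (alpha k) = (0 :: 'a S)" if "k \<noteq> 2" "k \<noteq> 3" for k
    using that by (cases k rule: all_3E) (simp_all add: partial_alpha)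
  then have "CHAR('a) dvd \<zeta> $ 2"
    using dvd[OF derivation_partial_y, of 2 3] by (simp add: partial_alpha)
  ultimately show ?thesis by (cases i rule: all_3E) simp_all
qed

text \<open>Radius 1 makes the size odd. A larger radius allows division of center and radius by
  \<open>p\<close>, and the smaller center is again a balanced peak, so induction applies.\<close>

lemma peak_radius_center:
  assumes p: "prime p" "CHAR('a::field) = p"
    and "peak TYPE('a) r \<zeta>" "0 < r" "\<zeta> \<in> Lambda_bal"
  shows "\<exists>k \<nu>. r = p ^ k \<and> \<zeta> = p ^ k *s \<nu> \<and> \<nu> \<in> Lambda_bal_odd"
  using assms(3-)
proof (induction r arbitrary: \<zeta> rule: less_induct)
  case (less r)
  note pk = less.prems(1)
  have \<Delta>: "Delta TYPE('a) \<zeta> = r" using pk by (simp add: peak_def)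
  show ?case
  proof (cases "r = 1")
    case True
    then have "odd (size_mult \<zeta>)" using size_mult_Delta[where 'a = 'a, of \<zeta>] \<Delta> by simp
    then have "\<zeta> \<in> Lambda_bal_odd" using less.prems(3) by (simp add: Lambda_bal_odd_def)
    moreover have "\<zeta> = p ^ 0 *s \<zeta>" by (simp add: vec_eq_iff)
    ultimately show ?thesis using True by (metis power_0)
  next
    case False
    then have r: "2 \<le> r" using less.prems(2) by simp
    define \<eta> :: multiplicity where "\<eta> = (\<chi> i. \<zeta> $ i div p)"
    have \<eta>: "\<zeta> = p *s \<eta>"
      using peak_dvd_coordinate[OF pk r less.prems(3)] p(2) by (simp add: vec_eq_iff \<eta>_def)
    define s where "s = Delta TYPE('a) \<eta>"
    have rs: "r = p * s" using \<Delta> Delta_frobenius[OF p] by (simp add: \<eta> s_def)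
    have "2 \<le> p" using p(1) by (rule prime_ge_2_nat)
    then have s: "0 < s" "s < r" using rs less.prems(2) by (auto intro: gr0I)
    have "peak TYPE('a) s \<eta>"
      unfolding peak_def
    proof (intro conjI allI impI)
      fix \<mu> assume "adjacent \<mu> \<eta>"
      then have "l1_dist \<mu> \<eta> = 1"
        using l1_dist_adjacent[of \<mu> \<eta> \<eta>] by auto
      \<comment> \<open>Multiplying a neighbour of \<open>\<eta>\<close> by \<open>p\<close> lands
        within radius \<open>r\<close> of \<open>\<zeta>\<close>, where the cone formula is known;
        Frobenius transfers the value back.\<close>
      then have "l1_dist (p *s \<mu>) \<zeta> = p" by (simp add: \<eta> l1_dist_smult)
      moreover have "p \<le> r" using s rs by simp
      ultimately have "p * Delta TYPE('a) \<mu> + p = p * s"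
        using Delta_peak[OF pk, of "p *s \<mu>"] Delta_frobenius[OF p] rs by simp
      then have "p * Suc (Delta TYPE('a) \<mu>) = p * s" by simp
      then show "Suc (Delta TYPE('a) \<mu>) = s" using \<open>2 \<le> p\<close> by (metis mult_cancel1 not_numeral_le_zero)
    qed (simp add: s_def)
    moreover have "\<eta> \<in> Lambda_bal"
    proof -
      have "p * (2 * \<eta> $ i) \<le> p * size_mult \<eta>" for i
        using less.prems(3) unfolding mem_Lambda_bal_iff \<eta> size_mult_smult smult_nth
        by (metis mult.left_commute)
      then show ?thesis using \<open>2 \<le> p\<close> by (simp add: mem_Lambda_bal_iff)
    qed
    ultimately obtain k \<nu> where k: "s = p ^ k" "\<eta> = p ^ k *s \<nu>" "\<nu> \<in> Lambda_bal_odd"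
      using less.IH s by blast
    have "r = p ^ Suc k" "\<zeta> = p ^ Suc k *s \<nu>"
      using rs k(1,2) by (simp_all add: \<eta> vec_eq_iff mult.assoc)
    then show ?thesis using k(3) by blast
  qed
qed

section \<open>Components and their peaks\<close>

definition pos_step :: "'a::field itself \<Rightarrow> multiplicity \<Rightarrow> multiplicity \<Rightarrow> bool" where
  "pos_step F \<mu> \<nu> \<longleftrightarrow> \<mu> \<in> Lambda_pos F \<and> \<nu> \<in> Lambda_pos F \<and> adjacent \<mu> \<nu>"

lemma components_posE:
  assumes "C \<in> components_pos F"
  obtains x where "x \<in> Lambda_pos F" "C = {\<nu> \<in> Lambda_pos F. equivclp (pos_step F) x \<nu>}"
proof -
  obtain x where "x \<in> Lambda_pos F" "C = connected_in (Lambda_pos F) `` {x}"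
    using assms unfolding components_pos_def by (rule quotientE)
  moreover have "pos_step F = (\<lambda>\<mu> \<nu>. \<mu> \<in> Lambda_pos F \<and> \<nu> \<in> Lambda_pos F \<and> adjacent \<mu> \<nu>)"
    by (intro ext) (rule pos_step_def)
  ultimately show thesis
    by (intro that[of x]) (auto simp: connected_in_def)
qed

lemma components_pos_subset: "C \<in> components_pos F \<Longrightarrow> C \<subseteq> Lambda_pos F"
  by (erule components_posE) blast

lemma components_pos_nonempty:
  assumes "C \<in> components_pos F"
  shows "C \<noteq> {}"
proof -
  obtain x where x: "x \<in> Lambda_pos F" "C = {\<nu> \<in> Lambda_pos F. equivclp (pos_step F) x \<nu>}"
    using assms by (rule components_posE)
  then have "x \<in> C" by simp
  then show ?thesis by blast
qed

lemma components_pos_adjacent: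
  assumes C: "C \<in> components_pos F" and "\<mu> \<in> C" "\<nu> \<in> Lambda_pos F" "adjacent \<mu> \<nu>"
  shows "\<nu> \<in> C"
proof -
  obtain x where x: "x \<in> Lambda_pos F" "C = {\<nu> \<in> Lambda_pos F. equivclp (pos_step F) x \<nu>}"
    using C by (rule components_posE)
  have "pos_step F \<mu> \<nu>" using assms x(2) by (simp add: pos_step_def)
  moreover have "equivclp (pos_step F) x \<mu>" using assms(2) x(2) by simp
  ultimately have "equivclp (pos_step F) x \<nu>" by (meson equivclp_trans r_into_equivclp)
  then show ?thesis using assms(3) x(2) by simp
qed

lemma components_pos_closed_subset:
  assumes C: "C \<in> components_pos F" and "\<zeta> \<in> C" "\<zeta> \<in> A"
    and closed: "\<And>\<mu> \<nu>. \<mu> \<in> A \<Longrightarrow> \<nu> \<in> Lambda_pos F \<Longrightarrow> adjacent \<mu> \<nu> \<Longrightarrow> \<nu> \<in> A"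
  shows "C \<subseteq> A"
proof
  obtain x where x: "x \<in> Lambda_pos F" "C = {\<nu> \<in> Lambda_pos F. equivclp (pos_step F) x \<nu>}"
    using C by (rule components_posE)
  fix \<nu> assume "\<nu> \<in> C"
  then have "equivclp (pos_step F) x \<zeta>" "equivclp (pos_step F) x \<nu>"
    using assms(2) x(2) by simp_all
  then have "equivclp (pos_step F) \<zeta> \<nu>" by (meson equivclp_sym equivclp_trans)
  then show "\<nu> \<in> A"
  proof (induction rule: equivclp_induct)
    case base
    show ?case by (rule assms(3))
  next
    case (step \<mu> \<nu>)
    \<comment> \<open>The generated equivalence may use a step in either direction; adjacency is
      symmetric.\<close>
    then have "adjacent \<mu> \<nu>" "\<nu> \<in> Lambda_pos F" by (auto simp: pos_step_def adjacent_iff)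
    with step.IH show ?case by (auto intro: closed)
  qed
qed

lemma size_mult_le_l1_dist: "size_mult \<mu> \<le> size_mult \<nu> + l1_dist \<mu> \<nu>"
  unfolding size_mult_3 l1_dist_3 by linarith

text \<open>\<open>Delta\<close> is maximized over the points of \<open>C\<close> that rise above
  \<open>\<mu>\<close> with slope at least one. There the bound by a third of the size keeps
  \<open>Delta\<close> bounded, and a higher neighbour of a maximizer would again be such a
  point.\<close>

lemma components_bal_pos_peak:
  assumes "C \<in> components_bal_pos TYPE('a::field)"
  obtains \<zeta> where "\<zeta> \<in> C" "peak TYPE('a) (Delta TYPE('a) \<zeta>) \<zeta>"
proof -
  let ?\<Delta> = "Delta TYPE('a)"
  have C: "C \<in> components_pos TYPE('a)" "C \<subseteq> Lambda_bal"
    using assms by (simp_all add: components_bal_pos_def)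
  obtain \<mu> where \<mu>: "\<mu> \<in> C" using components_pos_nonempty[OF C(1)] by blast
  define P where "P \<nu> \<longleftrightarrow> \<nu> \<in> C \<and> l1_dist \<nu> \<mu> + ?\<Delta> \<mu> \<le> ?\<Delta> \<nu>" for \<nu>
  have P\<mu>: "P \<mu>" using \<mu> by (simp add: P_def)
  have bound: "?\<Delta> \<nu> \<le> size_mult \<mu>" if "P \<nu>" for \<nu>
  proof -
    have "3 * ?\<Delta> \<nu> \<le> size_mult \<nu>" using that C(2) Lambda_bal_Delta_le by (auto simp: P_def)
    then show ?thesis using that size_mult_le_l1_dist[of \<nu> \<mu>] unfolding P_def by linarith
  qed
  have "\<exists>\<zeta>. P \<zeta> \<and> (\<forall>\<nu>. P \<nu> \<longrightarrow> ?\<Delta> \<nu> \<le> ?\<Delta> \<zeta>)"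
    by (rule ex_has_greatest_nat[of P \<mu> ?\<Delta> "Suc (size_mult \<mu>)"]) (simp_all add: P\<mu> bound le_imp_less_Suc)
  then obtain \<zeta> where \<zeta>: "P \<zeta>" "\<And>\<nu>. P \<nu> \<Longrightarrow> ?\<Delta> \<nu> \<le> ?\<Delta> \<zeta>" by blast
  have "Suc (?\<Delta> \<nu>) = ?\<Delta> \<zeta>" if adj: "adjacent \<nu> \<zeta>" for \<nu>
  proof (rule ccontr)
    assume "Suc (?\<Delta> \<nu>) \<noteq> ?\<Delta> \<zeta>"
    then have up: "?\<Delta> \<nu> = Suc (?\<Delta> \<zeta>)"
      using adj Delta_incr[where 'a = 'a] unfolding adjacent_iff by metis
    have "\<nu> \<in> C"
      using components_pos_adjacent[OF C(1), of \<zeta> \<nu>] \<zeta>(1) adj up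
      by (auto simp: P_def Lambda_pos_def adjacent_iff)
    moreover have "l1_dist \<nu> \<mu> \<le> Suc (l1_dist \<zeta> \<mu>)"
      using l1_dist_adjacent[OF adj, of \<mu>] by linarith
    ultimately have "P \<nu>" using \<zeta>(1) up by (simp add: P_def)
    then show False using \<zeta>(2) up by fastforce
  qed
  then show thesis using that[of \<zeta>] \<zeta>(1) by (simp add: P_def peak_def)
qed

text \<open>By the cone formula \<open>Delta\<close> is positive inside the ball and zero at
  distance \<open>r\<close>. So no positive step leaves the ball, and every point inside is linked
  to the center by steps inwards.\<close>

lemma component_eq_ball:
  assumes C: "C \<in> components_pos TYPE('a::field)" and \<zeta>: "\<zeta> \<in> C" "peak TYPE('a) r \<zeta>"
  shows "C = B \<zeta> r"
proof
  let ?\<Delta> = "Delta TYPE('a)"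
  have r: "0 < r"
    using components_pos_subset[OF C] \<zeta> by (auto simp: Lambda_pos_def peak_def)
  show "C \<subseteq> B \<zeta> r"
  proof (rule components_pos_closed_subset[OF C \<zeta>(1)])
    show "\<zeta> \<in> B \<zeta> r" using r by (simp add: B_def)
    fix \<mu> \<nu> assume "\<mu> \<in> B \<zeta> r" "\<nu> \<in> Lambda_pos TYPE('a)" "adjacent \<mu> \<nu>"
    then have "l1_dist \<nu> \<zeta> \<le> r" "0 < ?\<Delta> \<nu>"
      using l1_dist_adjacent[of \<mu> \<nu> \<zeta>] by (auto simp: B_def Lambda_pos_def)
    then show "\<nu> \<in> B \<zeta> r" using Delta_peak[OF \<zeta>(2), of \<nu>] by (simp add: B_def)
  qed
  have "\<mu> \<in> C" if "l1_dist \<mu> \<zeta> = n" "n < r" for \<mu> n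
    using that
  proof (induction n arbitrary: \<mu>)
    case 0
    then show ?case using \<zeta>(1) by simp
  next
    case (Suc n)
    obtain \<nu> where \<nu>: "adjacent \<mu> \<nu>" "l1_dist \<nu> \<zeta> = n"
      using l1_dist_inner_neighbour[OF Suc.prems(1)] by blast
    have "\<nu> \<in> C" using Suc.IH \<nu>(2) Suc.prems(2) by simp
    moreover have "\<mu> \<in> Lambda_pos TYPE('a)"
      using Delta_peak[OF \<zeta>(2), of \<mu>] Suc.prems by (simp add: Lambda_pos_def)
    moreover have "adjacent \<nu> \<mu>" using \<nu>(1) by (auto simp: adjacent_iff)
    ultimately show ?case by (rule components_pos_adjacent[OF C])
  qed
  then show "B \<zeta> r \<subseteq> C" by (auto simp: B_def)
qed

theorem theorem3p1:
  fixes p :: nat and C :: "multiplicity set"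
  assumes "prime p"
    and "CARD('a::field) = p"
    and "C \<in> components_bal_pos TYPE('a)"
  shows "\<exists>(k::nat) \<zeta>. \<zeta> \<in> (\<lambda>\<nu>. p ^ k *s \<nu>) ` Lambda_bal_odd \<and> C = B \<zeta> (p ^ k)"
proof -
  have C: "C \<in> components_pos TYPE('a)" "C \<subseteq> Lambda_bal"
    using assms(3) by (simp_all add: components_bal_pos_def)
  obtain \<zeta> where \<zeta>: "\<zeta> \<in> C" "peak TYPE('a) (Delta TYPE('a) \<zeta>) \<zeta>"
    by (rule components_bal_pos_peak[OF assms(3)])
  have "0 < Delta TYPE('a) \<zeta>"
    using components_pos_subset[OF C(1)] \<zeta>(1) by (auto simp: Lambda_pos_def)
  then obtain k \<nu> where "Delta TYPE('a) \<zeta> = p ^ k" "\<zeta> = p ^ k *s \<nu>" "\<nu> \<in> Lambda_bal_odd"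
    using peak_radius_center[OF assms(1) CHAR_eq_prime_CARD[OF assms(1,2)] \<zeta>(2)] \<zeta>(1) C(2) by blast
  then show ?thesis using component_eq_ball[OF C(1) \<zeta>] by auto
qed

end
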